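(* Let $E,A\in\mathbb{R}^{n\times n}$, $B\in\mathbb{R}^{n\times m}$, $C\in\mathbb{R}^{m\times n}$, and suppose that the descriptor system $E\dot x=Ax+Bu,\ y=Cx$ admits a pH representation $(J,R,Q,G,P)$ with nonsingular $Q$. Then there exist nonnegative integers $n_1,\dots,n_5,m_1$ with $n_1+n_2+n_3+n_4+n_5=n$ and $n_1+m_1+n_3=m$, and orthogonal matrices $U,V\in\mathbb{R}^{n\times n}$, $W\in\mathbb{R}^{m\times m}$ such that, with rows and columns of size $n$ partitioned as $(n_1,n_2,n_3,n_4,n_5)$ and those of size $m$ partitioned as $(n_1,m_1,n_3)$, $$UEV=\begin{bmatrix} \widetilde E_{11} & E_{12} & 0 & 0 & 0 \\ E_{21} & E_{22} & 0 & 0 & 0 \\ 0 & 0 & 0 & 0 & 0 \\ 0 & 0 & 0 & 0 & 0 \\ 0 & 0 & 0 & 0 & 0 \end{bmatrix},\qquad UBW=\begin{bmatrix} B_{11} & 0 & B_{13} \\ 0 & 0 & B_{23} \\ 0 & 0 & B_{33} \\ 0 & 0 & 0 \\ 0 & 0 & 0 \end{bmatrix},$$ $$UAV=\begin{bmatrix} A_{11} & A_{12} & A_{13} & A_{14} & A_{15} \\ A_{21} & A_{22} & A_{23} & A_{24} & A_{25} \\ A_{31} & A_{32} & A_{33} & A_{34} & A_{35} \\ A_{41} & A_{42} & A_{43} & A_{44} & 0 \\ A_{51} & A_{52} & A_{53} & 0 & 0 \end{bmatrix},\qquad W^TCV=\begin{bmatrix} C_{11} & 0 & 0 & 0 & 0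 \\ 0 & 0 & 0 & 0 & 0 \\ C_{31} & C_{32} & C_{33} & 0 & 0 \end{bmatrix},$$ where $\operatorname{rank}\begin{bmatrix} \widetilde E_{11} & E_{12} \\ E_{21} & E_{22} \end{bmatrix}=n_1+n_2$, $\operatorname{rank}(B_{11})=\operatorname{rank}(C_{11})=n_1$, $\operatorname{rank}(E_{22})=n_2$, $\operatorname{rank}(B_{33})=\operatorname{rank}(C_{33})=n_3$, and $\operatorname{rank}(A_{44})=n_4$.
   Context: All matrices are real; block sizes may be zero. $M\ge 0$ means $M$ is symmetric positive semidefinite. A pH (port-Hamiltonian) representation of the descriptor system $E\dot x=Ax+Bu,\ y=Cx$ (with $E,A\in\mathbb{R}^{n\times n}$, $B\in\mathbb{R}^{n\times m}$, $C\in\mathbb{R}^{m\times n}$) is a tuple of matrices $J,R,Q\in\mathbb{R}^{n\times n}$, $G,P\in\mathbb{R}^{n\times m}$ with $$A=(J-R)Q,\quad B=G-P,\quad C=(G+P)^TQ,$$ $$Q^TE=E^TQ\ge 0,\quad Q^TJQ=-(Q^TJQ)^T,\quad Q^TRQ\ge 0,\quad Q^TP=0.$$ *)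

theory Defs
  imports "Jordan_Normal_Form.DL_Rank"
begin

definition psd_mat :: "real mat \<Rightarrow> bool" where
  "psd_mat M \<longleftrightarrow> M\<^sup>T = M \<and> (\<forall>x \<in> carrier_vec (dim_row M). x \<bullet> (M *\<^sub>v x) \<ge> 0)"

(* The library's orthogonal_mat only asks for pairwise orthogonal nonzero columns,
   without normalisation, hence a separate predicate. *)
definition orthonormal_mat :: "nat \<Rightarrow> real mat \<Rightarrow> bool" where
  "orthonormal_mat n U \<longleftrightarrow> U \<in> carrier_mat n n \<and> U\<^sup>T * U = 1\<^sub>m n \<and> U * U\<^sup>T = 1\<^sub>m n"

definition pH_representation ::
  "nat \<Rightarrow> nat \<Rightarrow> real mat \<Rightarrow> real mat \<Rightarrow> real mat \<Rightarrow> real mat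
    \<Rightarrow> real mat \<Rightarrow> real mat \<Rightarrow> real mat \<Rightarrow> real mat \<Rightarrow> real mat \<Rightarrow> bool" where
  "pH_representation n m E A B C J R Q G P \<longleftrightarrow>
     J \<in> carrier_mat n n \<and> R \<in> carrier_mat n n \<and> Q \<in> carrier_mat n n \<and>
     G \<in> carrier_mat n m \<and> P \<in> carrier_mat n m \<and>
     A = (J - R) * Q \<and> B = G - P \<and> C = (G + P)\<^sup>T * Q \<and>
     Q\<^sup>T * E = E\<^sup>T * Q \<and> psd_mat (Q\<^sup>T * E) \<and>
     Q\<^sup>T * J * Q = - ((Q\<^sup>T * J * Q)\<^sup>T) \<and>
     psd_mat (Q\<^sup>T * R * Q) \<and>
     Q\<^sup>T * P = 0\<^sub>m n m"

(* Horizontal counterpart of the library's append_rows; it binds more tightly,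
   so that a block matrix can be written row by row. *)
definition append_cols :: "'a :: zero mat \<Rightarrow> 'a mat \<Rightarrow> 'a mat" (infixr \<open>@\<^sub>c\<close> 66) where
  "A @\<^sub>c B = four_block_mat A B (0\<^sub>m 0 (dim_col A)) (0\<^sub>m 0 (dim_col B))"

abbreviation mat_rank :: "real mat \<Rightarrow> nat" where
  "mat_rank M \<equiv> vec_space.rank (dim_row M) M"

end

theory Submission
  imports Defs
begin

text \<open>Nonsingularity of \<open>Q\<close> forces \<open>P = 0\<close>, hence \<open>C = B\<^sup>T Q\<close>, while \<open>S = Q\<^sup>T E\<close> is positive
semidefinite and \<open>Q\<^sup>T A\<close> is dissipative. Orthogonal \<open>V\<close> and \<open>W\<close> first reduce these congruence-type
data: \<open>V\<close> splits off the kernel of \<open>S\<close>, then, within that kernel, the kernel of \<open>C\<close>, then the kernel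
of the part of \<open>Q\<^sup>T A\<close> living there, which by dissipativity is also the kernel of its transpose;
\<open>W\<close> puts the values of \<open>C\<close> on the kernel of \<open>S\<close> last, and the remaining rows of \<open>C\<close> are compressed
on the complement of that kernel.
Next \<open>U\<close> is chosen by a QR factorisation such that \<open>T = U Q\<^sup>-\<^sup>T V\<close> is upper triangular. Since
\<open>U E V = T (V\<^sup>T S V)\<close>, \<open>U A V = T (V\<^sup>T Q\<^sup>T A V)\<close> and \<open>U B W = T (W\<^sup>T C V)\<^sup>T\<close>, and multiplying by
an upper triangular matrix from the left keeps zeros below the diagonal blocks, the block patterns
survive; the invertible diagonal blocks of \<open>T\<close> preserve the ranks.\<close>

subsection \<open>Orthogonal matrices\<close>

lemma orthonormal_matD:
  assumes "orthonormal_mat n U"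
  shows "U \<in> carrier_mat n n" "U\<^sup>T * U = 1\<^sub>m n" "U * U\<^sup>T = 1\<^sub>m n"
  using assms unfolding orthonormal_mat_def by auto

lemma orthonormal_mat_one: "orthonormal_mat n (1\<^sub>m n)"
  by (simp add: orthonormal_mat_def)

lemma orthonormal_mat_transpose: "orthonormal_mat n U \<Longrightarrow> orthonormal_mat n U\<^sup>T"
  by (auto simp: orthonormal_mat_def)

lemma orthonormal_mat_mult:
  assumes U: "orthonormal_mat n U" and V: "orthonormal_mat n V"
  shows "orthonormal_mat n (U * V)"
proof -
  note u = orthonormal_matD[OF U] and v = orthonormal_matD[OF V]
  have "(U * V)\<^sup>T * (U * V) = V\<^sup>T * ((U\<^sup>T * U) * V)"
    using u(1) v(1) by (simp add: transpose_mult[of U n n V n] assoc_mult_mat[of _ n n _ n _ n])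
  moreover have "(U * V) * (U * V)\<^sup>T = U * ((V * V\<^sup>T) * U\<^sup>T)"
    using u(1) v(1) by (simp add: transpose_mult[of U n n V n] assoc_mult_mat[of _ n n _ n _ n])
  ultimately show ?thesis
    using u v by (simp add: orthonormal_mat_def)
qed

lemma orthonormal_mat_det:
  assumes "orthonormal_mat n U"
  shows "det U \<noteq> 0"
proof
  assume "det U = 0"
  with det_mult[of "U\<^sup>T" n U] orthonormal_matD[OF assms] show False by simp
qed

lemma orthonormal_mat_eq_0_iff:
  assumes "orthonormal_mat n U" "x \<in> carrier_vec n"
  shows "U *\<^sub>v x = 0\<^sub>v n \<longleftrightarrow> x = 0\<^sub>v n"
proof
  note u = orthonormal_matD[OF assms(1)]
  assume "U *\<^sub>v x = 0\<^sub>v n"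
  moreover have "U\<^sup>T *\<^sub>v (U *\<^sub>v x) = x"
    using u assms(2) by (simp add: assoc_mult_mat_vec[symmetric, of _ n n _ n])
  ultimately show "x = 0\<^sub>v n" using u(1) by auto
qed (use orthonormal_matD(1)[OF assms(1)] in auto)

section \<open>Block diagonal sums of matrices\<close>

definition dsum :: "'a :: zero mat \<Rightarrow> 'a mat \<Rightarrow> 'a mat" where
  "dsum A D = four_block_mat A (0\<^sub>m (dim_row A) (dim_col D)) (0\<^sub>m (dim_row D) (dim_col A)) D"

lemma dsum_carrier: "A \<in> carrier_mat p q \<Longrightarrow> D \<in> carrier_mat p' q' \<Longrightarrow> dsum A D \<in> carrier_mat (p + p') (q + q')"
  by (simp add: dsum_def)

lemma transpose_dsum: "(dsum A D)\<^sup>T = dsum A\<^sup>T D\<^sup>T"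
  by (simp add: dsum_def transpose_four_block_mat[where ?nr1.0 = "dim_row A" and ?nc1.0 = "dim_col A"
      and ?nr2.0 = "dim_row D" and ?nc2.0 = "dim_col D"])

lemma dsum_mult_four_block:
  assumes "U \<in> carrier_mat p1 p1" "U' \<in> carrier_mat p2 p2"
    "A \<in> carrier_mat p1 q1" "B \<in> carrier_mat p1 q2" "C \<in> carrier_mat p2 q1" "D \<in> carrier_mat p2 q2"
  shows "dsum U U' * four_block_mat A B C D = four_block_mat (U * A) (U * B) (U' * C) (U' * D)"
  using assms by (simp add: dsum_def mult_four_block_mat[of _ p1 p1 _ p2 _ p2 _ _ q1 _ q2])

lemma four_block_mult_dsum:
  assumes "V \<in> carrier_mat q1 q1" "V' \<in> carrier_mat q2 q2"
    "A \<in> carrier_mat p1 q1" "B \<in> carrier_mat p1 q2" "C \<in> carrier_mat p2 q1" "D \<in> carrier_mat p2 q2"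
  shows "four_block_mat A B C D * dsum V V' = four_block_mat (A * V) (B * V') (C * V) (D * V')"
  using assms by (simp add: dsum_def mult_four_block_mat[of _ p1 q1 _ q2 _ p2 _ _ q1 _ q2])

lemma orthonormal_mat_dsum:
  assumes U: "orthonormal_mat p U" and V: "orthonormal_mat q V"
  shows "orthonormal_mat (p + q) (dsum U V)"
proof -
  note u = orthonormal_matD[OF U] and v = orthonormal_matD[OF V]
  have *: "dsum (1\<^sub>m p) (1\<^sub>m q) = (1\<^sub>m (p + q) :: real mat)"
    by (rule eq_matI) (auto simp: dsum_def)
  have "dsum X Y * dsum X' Y' = dsum (X * X') (Y * Y')"
    if "X \<in> carrier_mat p p" "X' \<in> carrier_mat p p" "Y \<in> carrier_mat q q" "Y' \<in> carrier_mat q q"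
    for X X' Y Y' :: "real mat"
    using that by (subst (2) dsum_def, subst dsum_mult_four_block[of X p Y q _ p _ q]) (auto simp: dsum_def)
  with u v show ?thesis
    by (simp add: orthonormal_mat_def transpose_dsum dsum_carrier *)
qed

text \<open>The Householder reflection in the hyperplane orthogonal to \<open>x - y\<close> swaps
  two vectors of equal length; being symmetric and its own inverse, it is orthogonal.\<close>

lemma ex_orthonormal_mat_maps_unit:
  fixes x y :: "real vec"
  assumes x: "x \<in> carrier_vec n" "x \<bullet> x = 1" and y: "y \<in> carrier_vec n" "y \<bullet> y = 1"
  shows "\<exists>H. orthonormal_mat n H \<and> H *\<^sub>v x = y"
proof -
  define w where "w = x - y"
  \<comment> \<open>For \<open>x = y\<close> division by zero makes \<open>c\<close> vanish and
    \<open>H\<close> becomes the identity, which still maps \<open>x\<close> to \<open>y\<close>.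
    The two alternatives of \<open>cw\<close> below reflect this.\<close>
  define c where "c = 2 / (w \<bullet> w)"
  define H where "H = mat n n (\<lambda>(i, j). (if i = j then 1 else 0) - c * w $ i * w $ j)"
  have w: "w \<in> carrier_vec n" using x y by (simp add: w_def)
  have H: "H \<in> carrier_mat n n" by (simp add: H_def)
  have HT: "H\<^sup>T = H" by (rule eq_matI) (auto simp: H_def)
  have Hv: "H *\<^sub>v v = v - (c * (w \<bullet> v)) \<cdot>\<^sub>v w" if v: "v \<in> carrier_vec n" for v
  proof (rule eq_vecI)
    fix i assume "i < dim_vec (v - (c * (w \<bullet> v)) \<cdot>\<^sub>v w)"
    hence i: "i < n" using w by simp
    have "(H *\<^sub>v v) $ i = (\<Sum>j = 0..<n. (if j = i then v $ j else 0) - c * w $ i * (w $ j * v $ j))"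
      using i v H by (simp add: H_def scalar_prod_def) (auto intro!: sum.cong simp: algebra_simps)
    also have "\<dots> = v $ i - c * w $ i * (w \<bullet> v)"
      using i v by (simp add: sum_subtractf sum_distrib_left[symmetric] scalar_prod_def)
    finally show "(H *\<^sub>v v) $ i = (v - (c * (w \<bullet> v)) \<cdot>\<^sub>v w) $ i"
      using i w v by (simp add: algebra_simps)
  qed (use H w v in auto)
  have cw: "w = 0\<^sub>v n \<or> c * (w \<bullet> w) = 2"
    using w conjugate_square_eq_0_vec[OF w] by (auto simp: c_def)
  have HH: "H *\<^sub>v (H *\<^sub>v v) = v" if v: "v \<in> carrier_vec n" for v
  proof -
    \<comment> \<open>The reflection negates the component along \<open>w\<close>, so a second
      application restores \<open>v\<close>.\<close>
    have "c * (w \<bullet> (v - (c * (w \<bullet> v)) \<cdot>\<^sub>v w)) = - (c * (w \<bullet> v))"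
      using cw v w by (auto simp: scalar_prod_minus_distrib algebra_simps)
    thus ?thesis using v w by (subst (2) Hv, simp, subst Hv) (auto intro!: eq_vecI)
  qed
  have "H * H = 1\<^sub>m n"
  proof (rule eq_matI)
    fix i j assume ij: "i < dim_row (1\<^sub>m n :: real mat)" "j < dim_col (1\<^sub>m n :: real mat)"
    have "X $$ (i, j) = (X *\<^sub>v unit_vec n j) $ i" if "X \<in> carrier_mat n n" for X :: "real mat"
      using that ij by simp
    from this[of "H * H"] have "(H * H) $$ (i, j) = (H *\<^sub>v (H *\<^sub>v unit_vec n j)) $ i"
      using H by (simp add: assoc_mult_mat_vec[of _ n n _ n])
    thus "(H * H) $$ (i, j) = 1\<^sub>m n $$ (i, j)" using ij HH[of "unit_vec n j"] by simp
  qed (use H in auto)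
  hence "orthonormal_mat n H" using H HT by (simp add: orthonormal_mat_def)
  moreover have "H *\<^sub>v x = y"
  proof -
    have "x \<bullet> y = y \<bullet> x" by (rule comm_scalar_prod[OF x(1) y(1)])
    \<comment> \<open>Both lengths are 1, so each side equals
      \<open>2 - 2 * (x \<bullet> y)\<close>. For \<open>w\<close> nonzero the coefficient in
      \<open>Hv\<close> at \<open>x\<close> is then 1, and \<open>H\<close> maps \<open>x\<close> to
      \<open>x - w = y\<close>.\<close>
    hence "w \<bullet> w = 2 * (w \<bullet> x)"
      using x y by (simp add: w_def minus_scalar_prod_distrib[of _ n] scalar_prod_minus_distrib[of _ n])
    with cw have "w = 0\<^sub>v n \<or> c * (w \<bullet> x) = 1" by simp
    thus ?thesis
    proof
      assume "w = 0\<^sub>v n"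
      hence "x $ i - y $ i = 0" if "i < n" for i
        using x y that index_minus_vec(1)[of i y x] by (simp add: w_def)
      hence "x = y" using x y by (intro eq_vecI) auto
      thus ?thesis using Hv[OF x(1)] w \<open>w = 0\<^sub>v n\<close> x by auto
    next
      assume "c * (w \<bullet> x) = 1"
      thus ?thesis using Hv[OF x(1)] w x y by (auto simp: w_def intro!: eq_vecI)
    qed
  qed
  ultimately show ?thesis by blast
qed

text \<open>A nonzero \<open>x\<close> is scaled to unit length and reflected onto the axis;
  \<open>c\<close> is its length. The axis \<open>k\<close> is free because kernel compression uses
  the last axis and the QR factorisation the first. The final conjunct permits cancelling
  \<open>c\<close>.\<close>

lemma ex_orthonormal_mat_maps_to_axis:
  fixes x :: "real vec"
  assumes x: "x \<in> carrier_vec n" and k: "k < n"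
  shows "\<exists>H c. orthonormal_mat n H \<and> H *\<^sub>v x = c \<cdot>\<^sub>v unit_vec n k \<and> (x \<noteq> 0\<^sub>v n \<longrightarrow> c \<noteq> 0)"
proof (cases "x = 0\<^sub>v n")
  case True
  thus ?thesis using orthonormal_mat_one[of n] by (intro exI[of _ "1\<^sub>m n"] exI[of _ 0]) auto
next
  case False
  hence pos: "x \<bullet> x > 0"
    using conjugate_square_greater_0_vec[OF x] by simp
  define c where "c = sqrt (x \<bullet> x)"
  have c: "c \<noteq> 0" "c * c = x \<bullet> x" using pos by (auto simp: c_def)
  have "\<exists>H. orthonormal_mat n H \<and> H *\<^sub>v ((1 / c) \<cdot>\<^sub>v x) = unit_vec n k"
    by (rule ex_orthonormal_mat_maps_unit) (use x k c in \<open>auto simp: field_simps\<close>)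
  then obtain H where H: "orthonormal_mat n H" "H *\<^sub>v ((1 / c) \<cdot>\<^sub>v x) = unit_vec n k" by blast
  have "H *\<^sub>v x = c \<cdot>\<^sub>v (H *\<^sub>v ((1 / c) \<cdot>\<^sub>v x))"
    using orthonormal_matD(1)[OF H(1)] x c by (simp add: mult_mat_vec smult_smult_assoc)
  with H c show ?thesis by metis
qed

text \<open>Induction on the number of columns: a nonzero kernel vector is rotated onto the last
  axis, which clears the last column, and the remaining columns are treated recursively. The
  conclusion says that the kernel of \<open>M * V\<close> is spanned by the axes from
  \<open>r\<close> on, so \<open>r\<close> is the rank, expressed through kernels alone.\<close>

lemma ex_right_compression:
  fixes M :: "real mat"
  assumes "M \<in> carrier_mat p q"
  shows "\<exists>V r. orthonormal_mat q V \<and> r \<le> q \<and>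
    (\<forall>x \<in> carrier_vec q. M *\<^sub>v (V *\<^sub>v x) = 0\<^sub>v p \<longleftrightarrow> (\<forall>i<r. x $ i = 0))"
  using assms
proof (induction q arbitrary: M)
  case 0
  thus ?case using orthonormal_mat_one[of 0]
    by (intro exI[of _ "1\<^sub>m 0"] exI[of _ 0]) (auto intro!: eq_vecI simp: scalar_prod_def)
next
  case (Suc k M)
  show ?case
  proof (cases "\<forall>x \<in> carrier_vec (Suc k). M *\<^sub>v x = 0\<^sub>v p \<longrightarrow> x = 0\<^sub>v (Suc k)")
    case True
    have "M *\<^sub>v x = 0\<^sub>v p \<longleftrightarrow> (\<forall>i<Suc k. x $ i = 0)" if x: "x \<in> carrier_vec (Suc k)" for x
    proof
      assume "\<forall>i<Suc k. x $ i = 0"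
      hence "x = 0\<^sub>v (Suc k)" using x by (intro eq_vecI) auto
      thus "M *\<^sub>v x = 0\<^sub>v p" using Suc.prems by auto
    qed (use True x in auto)
    thus ?thesis using orthonormal_mat_one[of "Suc k"]
      by (intro exI[of _ "1\<^sub>m (Suc k)"] exI[of _ "Suc k"]) auto
  next
    case False
    then obtain x where x: "x \<in> carrier_vec (Suc k)" "M *\<^sub>v x = 0\<^sub>v p" "x \<noteq> 0\<^sub>v (Suc k)" by blast
    obtain H c where H: "orthonormal_mat (Suc k) H" and Hx: "H *\<^sub>v x = c \<cdot>\<^sub>v unit_vec (Suc k) k" and c: "c \<noteq> 0"
      using ex_orthonormal_mat_maps_to_axis[OF x(1), of k] x(3) by auto
    note h = orthonormal_matD[OF H]
    define N where "N = M * H\<^sup>T"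
    have N: "N \<in> carrier_mat p (Suc k)" using Suc.prems h by (simp add: N_def)
    \<comment> \<open>\<open>H\<close> sends \<open>x\<close> to a multiple of the last axis, so
      \<open>N\<close> sends that multiple back to \<open>M\<close> applied to \<open>x\<close>,
      which is zero. Cancelling \<open>c\<close> shows that the last column of \<open>N\<close>
      vanishes.\<close>
    have "N *\<^sub>v (c \<cdot>\<^sub>v unit_vec (Suc k) k) = M *\<^sub>v ((H\<^sup>T * H) *\<^sub>v x)"
      unfolding Hx[symmetric] N_def using x(1) Suc.prems h(1)
      by (simp add: assoc_mult_mat_vec[of _ p "Suc k" _ "Suc k"] assoc_mult_mat_vec[of _ "Suc k" "Suc k" _ "Suc k"])
    hence "c \<cdot>\<^sub>v (N *\<^sub>v unit_vec (Suc k) k) = 0\<^sub>v p"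
      using x h(2) N by (simp add: mult_mat_vec)
    hence "c * (N *\<^sub>v unit_vec (Suc k) k) $ i = 0" if "i < p" for i
      using that N index_smult_vec(1)[of i "N *\<^sub>v unit_vec (Suc k) k" c] by simp
    hence col0: "N $$ (i, k) = 0" if "i < p" for i
      using that N c by auto
    define N' where "N' = mat p k (\<lambda>(i, j). N $$ (i, j))"
    have N': "N' \<in> carrier_mat p k" by (simp add: N'_def)
    have Nv: "N *\<^sub>v (a @\<^sub>v b) = N' *\<^sub>v a" if "a \<in> carrier_vec k" "b \<in> carrier_vec 1" for a b
    proof (rule eq_vecI)
      fix i assume "i < dim_vec (N' *\<^sub>v a)"
      thus "(N *\<^sub>v (a @\<^sub>v b)) $ i = (N' *\<^sub>v a) $ i"
        using that N col0 by (simp add: N'_def scalar_prod_def)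
    qed (use N in \<open>simp add: N'_def\<close>)
    obtain V' r where V': "orthonormal_mat k V'" and r: "r \<le> k"
      and ker: "\<And>x. x \<in> carrier_vec k \<Longrightarrow> N' *\<^sub>v (V' *\<^sub>v x) = 0\<^sub>v p \<longleftrightarrow> (\<forall>i<r. x $ i = 0)"
      using Suc.IH[OF N'] by blast
    note v' = orthonormal_matD[OF V']
    define D where "D = dsum V' (1\<^sub>m 1 :: real mat)"
    have D: "orthonormal_mat (Suc k) D"
      using orthonormal_mat_dsum[OF V' orthonormal_mat_one[of 1]] by (simp add: D_def)
    \<comment> \<open>On the first \<open>k\<close> coordinates the map is \<open>N' * V'\<close>;
      the last coordinate is unconstrained on both sides because \<open>r \<le> k\<close>.\<close>
    have "M *\<^sub>v ((H\<^sup>T * D) *\<^sub>v x) = 0\<^sub>v p \<longleftrightarrow> (\<forall>i<r. x $ i = 0)" if x: "x \<in> carrier_vec (Suc k)" for x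
    proof -
      define a b where "a = vec_first x k" and "b = vec_last x 1"
      have ab: "a \<in> carrier_vec k" "b \<in> carrier_vec 1" "x = a @\<^sub>v b"
        using x by (auto simp: a_def b_def)
      have "D *\<^sub>v x = (V' *\<^sub>v a) @\<^sub>v (1\<^sub>m 1 *\<^sub>v b)"
        unfolding D_def ab(3) dsum_def using v' ab(1,2) by (simp add: mult_mat_vec_split[of V' k])
      moreover have "M *\<^sub>v ((H\<^sup>T * D) *\<^sub>v x) = N *\<^sub>v (D *\<^sub>v x)"
        using Suc.prems h(1) x orthonormal_matD(1)[OF D] 
        by (simp add: N_def assoc_mult_mat_vec[of _ p "Suc k" _ "Suc k"] assoc_mult_mat_vec[of _ "Suc k" "Suc k" _ "Suc k"])
      ultimately have "M *\<^sub>v ((H\<^sup>T * D) *\<^sub>v x) = N' *\<^sub>v (V' *\<^sub>v a)"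
        using Nv[of "V' *\<^sub>v a" b] v'(1) ab by simp
      moreover have "(\<forall>i<r. x $ i = 0) \<longleftrightarrow> (\<forall>i<r. a $ i = 0)"
        using ab r by auto
      ultimately show ?thesis using ker[OF ab(1)] by simp
    qed
    thus ?thesis
      using orthonormal_mat_mult[OF orthonormal_mat_transpose[OF H] D] r
      by (intro exI[of _ "H\<^sup>T * D"] exI[of _ r]) auto
  qed
qed

subsection \<open>Rank-revealing compressions\<close>

lemma det_nonzero_iff_injective:
  fixes D :: "'a :: field mat"
  assumes "D \<in> carrier_mat n n"
  shows "det D \<noteq> 0 \<longleftrightarrow> (\<forall>x \<in> carrier_vec n. D *\<^sub>v x = 0\<^sub>v n \<longrightarrow> x = 0\<^sub>v n)"
  using det_0_iff_vec_prod_zero_field[OF assms] by blast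

text \<open>If \<open>p < q\<close>, padding \<open>D\<close> with zero rows gives a square matrix
  whose row \<open>p\<close> is zero. It is singular, and a nonzero vector in its kernel also lies
  in the kernel of \<open>D\<close>.\<close>

lemma injective_imp_dim_le:
  fixes D :: "'a :: field mat"
  assumes D: "D \<in> carrier_mat p q"
    and inj: "\<And>x. x \<in> carrier_vec q \<Longrightarrow> D *\<^sub>v x = 0\<^sub>v p \<Longrightarrow> x = 0\<^sub>v q"
  shows "q \<le> p"
proof (rule ccontr)
  assume "\<not> q \<le> p"
  hence pq: "p < q" by simp
  define S where "S = mat q q (\<lambda>(i, j). if i < p then D $$ (i, j) else 0)"
  have S: "S \<in> carrier_mat q q" by (simp add: S_def)
  have "S\<^sup>T *\<^sub>v unit_vec q p = 0\<^sub>v q"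
    using pq by (intro eq_vecI) (auto simp: S_def)
  moreover have "unit_vec q p \<noteq> (0\<^sub>v q :: 'a vec)"
    using pq by simp
  ultimately have "det S\<^sup>T = 0"
    using det_nonzero_iff_injective[of "S\<^sup>T" q] S by (meson transpose_carrier_mat unit_vec_carrier)
  hence "det S = 0" using det_transpose[OF S] by simp
  then obtain v where v: "v \<in> carrier_vec q" "v \<noteq> 0\<^sub>v q" "S *\<^sub>v v = 0\<^sub>v q"
    using det_nonzero_iff_injective[OF S] by blast
  have "D *\<^sub>v v = 0\<^sub>v p"
  proof (rule eq_vecI)
    fix i assume "i < dim_vec (0\<^sub>v p :: 'a vec)"
    hence i: "i < p" by simp
    have "(D *\<^sub>v v) $ i = (S *\<^sub>v v) $ i"
      using i pq D S v(1) by (simp add: S_def scalar_prod_def)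
    thus "(D *\<^sub>v v) $ i = 0\<^sub>v p $ i" using v i pq by simp
  qed (use D in simp)
  with inj v show False by blast
qed

lemma axis_kernel_entry_zero:
  fixes N :: "'a :: comm_ring_1 mat"
  assumes N: "N \<in> carrier_mat p q"
    and ker: "\<And>x. x \<in> carrier_vec q \<Longrightarrow> \<forall>i<r. x $ i = 0 \<Longrightarrow> N *\<^sub>v x = 0\<^sub>v p"
    and ij: "i < p" "r \<le> j" "j < q"
  shows "N $$ (i, j) = 0"
proof -
  have "N $$ (i, j) = (N *\<^sub>v unit_vec q j) $ i" using N ij by simp
  also have "N *\<^sub>v unit_vec q j = 0\<^sub>v p"
    by (rule ker) (use ij in auto)
  finally show ?thesis using ij by simp
qed

text \<open>A kernel vector of the leading block, padded with zeros, is a kernel vector of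
  \<open>N\<close>, since the rows from \<open>t\<close> on vanish. The description of the kernel of
  \<open>N\<close> then forces its first \<open>r\<close> entries to be zero.\<close>

lemma axis_kernel_leading_block_injective:
  fixes N :: "'a :: comm_ring_1 mat"
  assumes N: "N \<in> carrier_mat p q" and r: "r \<le> q" and t: "t \<le> p"
    and ker: "\<And>x. x \<in> carrier_vec q \<Longrightarrow> N *\<^sub>v x = 0\<^sub>v p \<longleftrightarrow> (\<forall>i<r. x $ i = 0)"
    and low: "\<And>i j. t \<le> i \<Longrightarrow> i < p \<Longrightarrow> j < q \<Longrightarrow> N $$ (i, j) = 0"
    and x: "x \<in> carrier_vec r" "mat t r (($$) N) *\<^sub>v x = 0\<^sub>v t"
  shows "x = 0\<^sub>v r"
proof -
  define y where "y = x @\<^sub>v 0\<^sub>v (q - r)"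
  have y: "y \<in> carrier_vec q" using append_carrier_vec[OF x(1), of "0\<^sub>v (q - r)" "q - r"] r by (simp add: y_def)
  have "N *\<^sub>v y = 0\<^sub>v p"
  proof (rule eq_vecI)
    fix i assume "i < dim_vec (0\<^sub>v p :: 'a vec)"
    hence i: "i < p" by simp
    show "(N *\<^sub>v y) $ i = 0\<^sub>v p $ i"
    proof (cases "i < t")
      case True
      have q: "{0..<q} = {0..<r} \<union> {r..<q}" using r by auto
      have "(N *\<^sub>v y) $ i = (mat t r (($$) N) *\<^sub>v x) $ i"
        using True i N x(1) y r unfolding y_def
        by (auto simp add: scalar_prod_def q sum.union_disjoint intro!: sum.neutral)
      thus ?thesis using x(2) True i by simp
    next
      case False
      thus ?thesis using low[of i] i N y by (simp add: scalar_prod_def)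
    qed
  qed (use N in simp)
  hence z: "\<forall>i<r. y $ i = 0" using ker[OF y] by simp
  show ?thesis
  proof (rule eq_vecI)
    fix i assume "i < dim_vec (0\<^sub>v r :: 'a vec)"
    thus "x $ i = 0\<^sub>v r $ i" using z x(1) by (auto simp: y_def)
  qed (use x in simp)
qed

text \<open>The two kernels confine \<open>N\<close> to its leading \<open>t\<close> by
  \<open>r\<close> block. This block and its transpose are both injective, so it is square and
  nonsingular.\<close>

lemma axis_kernels_imp_block:
  fixes N :: "'a :: field mat"
  assumes N: "N \<in> carrier_mat p q" and r: "r \<le> q" and t: "t \<le> p"
    and ker: "\<And>x. x \<in> carrier_vec q \<Longrightarrow> N *\<^sub>v x = 0\<^sub>v p \<longleftrightarrow> (\<forall>i<r. x $ i = 0)"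
    and kerT: "\<And>x. x \<in> carrier_vec p \<Longrightarrow> N\<^sup>T *\<^sub>v x = 0\<^sub>v q \<longleftrightarrow> (\<forall>i<t. x $ i = 0)"
  shows "\<exists>k p' q' D. p = k + p' \<and> q = k + q' \<and> D \<in> carrier_mat k k \<and> det D \<noteq> 0 \<and>
    N = four_block_mat D (0\<^sub>m k q') (0\<^sub>m p' k) (0\<^sub>m p' q')"
proof -
  have right: "N $$ (i, j) = 0" if "i < p" "r \<le> j" "j < q" for i j
    using axis_kernel_entry_zero[OF N _ that] ker by blast
  have low: "N $$ (i, j) = 0" if "t \<le> i" "i < p" "j < q" for i j
    using axis_kernel_entry_zero[of "N\<^sup>T" q p t j i] kerT N that by auto
  have NT: "N\<^sup>T \<in> carrier_mat q p" using N by simp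
  have inj: "x = 0\<^sub>v r" if "x \<in> carrier_vec r" "mat t r (($$) N) *\<^sub>v x = 0\<^sub>v t" for x
    using axis_kernel_leading_block_injective[OF N r t ker low that] .
  have injT: "x = 0\<^sub>v t" if "x \<in> carrier_vec t" "mat r t (($$) N\<^sup>T) *\<^sub>v x = 0\<^sub>v r" for x
    by (rule axis_kernel_leading_block_injective[OF NT t r kerT _ that]) (use right N in auto)
  have "r \<le> t" by (rule injective_imp_dim_le[OF _ inj]) auto
  moreover have "t \<le> r" by (rule injective_imp_dim_le[OF _ injT]) auto
  ultimately have tr: "t = r" by simp
  define D where "D = mat r r (($$) N)"
  have D: "D \<in> carrier_mat r r" by (simp add: D_def)
  have "det D \<noteq> 0" using det_nonzero_iff_injective[OF D] inj unfolding D_def tr by blast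
  moreover have "N = four_block_mat D (0\<^sub>m r (q - r)) (0\<^sub>m (p - r) r) (0\<^sub>m (p - r) (q - r))"
    by (rule eq_matI) (use N r t right low in \<open>auto simp: D_def tr\<close>)
  ultimately show ?thesis
    using D r t tr by (intro exI[of _ r] exI[of _ "p - r"] exI[of _ "q - r"] exI[of _ D]) auto
qed

text \<open>When \<open>M\<close> and its transpose have the same kernel, one orthogonal
  \<open>V\<close> adapted to that kernel compresses columns and rows at once. This serves both the
  symmetric \<open>S\<close> and the dissipative block.\<close>

lemma ex_congruence_compression:
  assumes M: "M \<in> carrier_mat n n"
    and ker: "\<And>x. x \<in> carrier_vec n \<Longrightarrow> M *\<^sub>v x = 0\<^sub>v n \<longleftrightarrow> M\<^sup>T *\<^sub>v x = 0\<^sub>v n"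
  shows "\<exists>V k l D. orthonormal_mat n V \<and> n = k + l \<and> D \<in> carrier_mat k k \<and> det D \<noteq> 0 \<and>
    V\<^sup>T * M * V = four_block_mat D (0\<^sub>m k l) (0\<^sub>m l k) (0\<^sub>m l l)"
proof -
  obtain V r where V: "orthonormal_mat n V" and r: "r \<le> n"
    and kV: "\<And>x. x \<in> carrier_vec n \<Longrightarrow> M *\<^sub>v (V *\<^sub>v x) = 0\<^sub>v n \<longleftrightarrow> (\<forall>i<r. x $ i = 0)"
    using ex_right_compression[OF M] by blast
  note v = orthonormal_matD[OF V]
  note VT = orthonormal_mat_transpose[OF V]
  have mv: "(V\<^sup>T * X * V) *\<^sub>v x = V\<^sup>T *\<^sub>v (X *\<^sub>v (V *\<^sub>v x))"
    if "X \<in> carrier_mat n n" "x \<in> carrier_vec n" for X x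
    using that v(1) by (simp add: assoc_mult_mat_vec[of _ n n _ n])
  have "(V\<^sup>T * M * V)\<^sup>T = V\<^sup>T * M\<^sup>T * V"
    using M v(1) by (simp add: transpose_mult[of _ n n _ n] assoc_mult_mat[of _ n n _ n _ n])
  moreover have "(V\<^sup>T * M * V) *\<^sub>v x = 0\<^sub>v n \<longleftrightarrow> (\<forall>i<r. x $ i = 0)" if "x \<in> carrier_vec n" for x
    using that mv[OF M that] kV[OF that] orthonormal_mat_eq_0_iff[OF VT] M v(1) by simp
  moreover have "(V\<^sup>T * M\<^sup>T * V) *\<^sub>v x = 0\<^sub>v n \<longleftrightarrow> (\<forall>i<r. x $ i = 0)" if "x \<in> carrier_vec n" for x
    using that mv[of "M\<^sup>T", OF _ that] kV[OF that] ker[of "V *\<^sub>v x"] orthonormal_mat_eq_0_iff[OF VT] M v(1) by simp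
  ultimately have "\<exists>k p' q' D. n = k + p' \<and> n = k + q' \<and> D \<in> carrier_mat k k \<and> det D \<noteq> 0 \<and>
    V\<^sup>T * M * V = four_block_mat D (0\<^sub>m k q') (0\<^sub>m p' k) (0\<^sub>m p' q')"
    using M v(1) by (intro axis_kernels_imp_block[OF _ r r]) auto
  then obtain k p' q' D where "n = k + p'" "n = k + q'" "D \<in> carrier_mat k k" "det D \<noteq> 0"
    "V\<^sup>T * M * V = four_block_mat D (0\<^sub>m k q') (0\<^sub>m p' k) (0\<^sub>m p' q')"
    by blast
  moreover from this(1,2) have "q' = p'" by simp
  ultimately show ?thesis using V by blast
qed

text \<open>\<open>V\<close> is adapted to the kernel of \<open>M\<close> and \<open>W\<close> to
  the kernel of its transpose: a complete orthogonal decomposition with core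
  \<open>D\<close>.\<close>

lemma ex_two_sided_compression:
  assumes M: "M \<in> carrier_mat p q"
  shows "\<exists>W V k p' q' D. orthonormal_mat p W \<and> orthonormal_mat q V \<and> p = k + p' \<and> q = k + q' \<and>
    D \<in> carrier_mat k k \<and> det D \<noteq> 0 \<and>
    W\<^sup>T * M * V = four_block_mat D (0\<^sub>m k q') (0\<^sub>m p' k) (0\<^sub>m p' q')"
proof -
  obtain V r where V: "orthonormal_mat q V" and r: "r \<le> q"
    and kV: "\<And>x. x \<in> carrier_vec q \<Longrightarrow> M *\<^sub>v (V *\<^sub>v x) = 0\<^sub>v p \<longleftrightarrow> (\<forall>i<r. x $ i = 0)"
    using ex_right_compression[OF M] by blast
  obtain W t where W: "orthonormal_mat p W" and t: "t \<le> p"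
    and kW: "\<And>x. x \<in> carrier_vec p \<Longrightarrow> M\<^sup>T *\<^sub>v (W *\<^sub>v x) = 0\<^sub>v q \<longleftrightarrow> (\<forall>i<t. x $ i = 0)"
    using ex_right_compression[of "M\<^sup>T" q p] M by auto
  note v = orthonormal_matD[OF V] and w = orthonormal_matD[OF W]
  note VT = orthonormal_mat_transpose[OF V] and WT = orthonormal_mat_transpose[OF W]
  have "(W\<^sup>T * M * V)\<^sup>T = V\<^sup>T * M\<^sup>T * W"
    using M v(1) w(1) by (simp add: transpose_mult[of _ p q _ q] transpose_mult[of _ p p _ q] assoc_mult_mat[of _ q q _ p _ p])
  moreover have "(W\<^sup>T * M * V) *\<^sub>v x = 0\<^sub>v p \<longleftrightarrow> (\<forall>i<r. x $ i = 0)" if "x \<in> carrier_vec q" for x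
  proof -
    have "(W\<^sup>T * M * V) *\<^sub>v x = W\<^sup>T *\<^sub>v (M *\<^sub>v (V *\<^sub>v x))"
      using that M v(1) w(1) by (simp add: assoc_mult_mat_vec[of _ p q _ q] assoc_mult_mat_vec[of _ p p _ q])
    thus ?thesis using that kV[OF that] orthonormal_mat_eq_0_iff[OF WT] M v(1) by simp
  qed
  moreover have "(V\<^sup>T * M\<^sup>T * W) *\<^sub>v x = 0\<^sub>v q \<longleftrightarrow> (\<forall>i<t. x $ i = 0)" if "x \<in> carrier_vec p" for x
  proof -
    have "(V\<^sup>T * M\<^sup>T * W) *\<^sub>v x = V\<^sup>T *\<^sub>v (M\<^sup>T *\<^sub>v (W *\<^sub>v x))"
      using that M v(1) w(1) by (simp add: assoc_mult_mat_vec[of _ q p _ p] assoc_mult_mat_vec[of _ q q _ p])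
    thus ?thesis using that kW[OF that] orthonormal_mat_eq_0_iff[OF VT] M w(1) by simp
  qed
  ultimately have "\<exists>k p' q' D. p = k + p' \<and> q = k + q' \<and> D \<in> carrier_mat k k \<and> det D \<noteq> 0 \<and>
    W\<^sup>T * M * V = four_block_mat D (0\<^sub>m k q') (0\<^sub>m p' k) (0\<^sub>m p' q')"
    using M v(1) w(1) by (intro axis_kernels_imp_block[OF _ r t]) simp_all
  thus ?thesis using V W by blast
qed

text \<open>The previous decomposition with the core moved to the last rows. This places the outputs
  that see the kernel of \<open>S\<close> last, where the third output block belongs.\<close>

lemma ex_two_sided_compression_bottom:
  assumes M: "M \<in> carrier_mat p q"
  shows "\<exists>W V k p' q' D. orthonormal_mat p W \<and> orthonormal_mat q V \<and> p = p' + k \<and> q = k + q' \<and>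
    D \<in> carrier_mat k k \<and> det D \<noteq> 0 \<and>
    W\<^sup>T * M * V = four_block_mat (0\<^sub>m p' k) (0\<^sub>m p' q') D (0\<^sub>m k q')"
proof -
  obtain W V k p' q' D where W: "orthonormal_mat p W" and V: "orthonormal_mat q V"
    and pq: "p = k + p'" "q = k + q'" and D: "D \<in> carrier_mat k k" "det D \<noteq> 0"
    and eq: "W\<^sup>T * M * V = four_block_mat D (0\<^sub>m k q') (0\<^sub>m p' k) (0\<^sub>m p' q')"
    using ex_two_sided_compression[OF M] by blast
  \<comment> \<open>Block permutation exchanging the first \<open>k\<close> and the last
    \<open>p'\<close> coordinates; its transpose moves \<open>D\<close> below the zero rows.\<close>
  define P :: "real mat" where "P = four_block_mat (0\<^sub>m k p') (1\<^sub>m k) (1\<^sub>m p') (0\<^sub>m p' k)"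
  have P: "P \<in> carrier_mat p p" using pq by (auto simp: P_def)
  have PT: "P\<^sup>T = four_block_mat (0\<^sub>m p' k) (1\<^sub>m p') (1\<^sub>m k) (0\<^sub>m k p')"
    by (simp add: P_def transpose_four_block_mat[of _ k p' _ k _ p'])
  have one: "four_block_mat (1\<^sub>m a) (0\<^sub>m a b) (0\<^sub>m b a) (1\<^sub>m b) = (1\<^sub>m (a + b) :: real mat)" for a b
    by (rule eq_matI) auto
  have "P\<^sup>T * P = 1\<^sub>m (p' + k)"
    unfolding PT unfolding P_def
    by (subst mult_four_block_mat[of _ p' k _ p' _ k _ _ p' _ k]) (simp_all add: one)
  moreover have "P * P\<^sup>T = 1\<^sub>m (k + p')"
    unfolding PT unfolding P_def
    by (subst mult_four_block_mat[of _ k p' _ k _ p' _ _ k _ p']) (simp_all add: one)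
  ultimately have "P\<^sup>T * P = 1\<^sub>m p" "P * P\<^sup>T = 1\<^sub>m p"
    using pq by (simp_all add: add.commute[of p' k])
  hence oP: "orthonormal_mat p P" using P by (simp add: orthonormal_mat_def)
  have "(W * P)\<^sup>T * M * V = P\<^sup>T * (W\<^sup>T * M * V)"
    using orthonormal_matD(1)[OF W] orthonormal_matD(1)[OF V] P M
    by (simp add: transpose_mult[of _ p p _ p] assoc_mult_mat[of _ p p _ p _ q]
        assoc_mult_mat[of _ p q _ q _ q] assoc_mult_mat[of _ p p _ q _ q])
  also have "\<dots> = four_block_mat (0\<^sub>m p' k) (0\<^sub>m p' q') D (0\<^sub>m k q')"
    unfolding eq PT using D
    by (subst mult_four_block_mat[of _ p' k _ p' _ k _ _ k _ q']) simp_all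
  finally have "(W * P)\<^sup>T * M * V = four_block_mat (0\<^sub>m p' k) (0\<^sub>m p' q') D (0\<^sub>m k q')" .
  moreover have "p = p' + k" using pq by simp
  ultimately show ?thesis
    using orthonormal_mat_mult[OF W oP] V pq(2) D by blast
qed

subsection \<open>Blocks and quadratic forms\<close>

text \<open>The corner comes first, then the size. With explicit offsets, blocks of blocks and of
  products are handled by adding numbers.\<close>

definition mat_block :: "'a mat \<Rightarrow> nat \<Rightarrow> nat \<Rightarrow> nat \<Rightarrow> nat \<Rightarrow> 'a mat" where
  "mat_block M i j p q = mat p q (\<lambda>(a, b). M $$ (i + a, j + b))"

lemma mat_block_carrier [simp]: "mat_block M i j p q \<in> carrier_mat p q"
  and dim_mat_block [simp]: "dim_row (mat_block M i j p q) = p" "dim_col (mat_block M i j p q) = q"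
  and mat_block_index [simp]: "a < p \<Longrightarrow> b < q \<Longrightarrow> mat_block M i j p q $$ (a, b) = M $$ (i + a, j + b)"
  by (simp_all add: mat_block_def)

lemma mat_block_mat_block:
  "a + p' \<le> p \<Longrightarrow> b + q' \<le> q \<Longrightarrow>
    mat_block (mat_block M i j p q) a b p' q' = mat_block M (i + a) (j + b) p' q'"
  by (rule eq_matI) (auto simp: add.assoc)

lemma mat_block_transpose:
  "M \<in> carrier_mat r c \<Longrightarrow> i + p \<le> c \<Longrightarrow> j + q \<le> r \<Longrightarrow>
    mat_block M\<^sup>T i j p q = (mat_block M j i q p)\<^sup>T"
  by (rule eq_matI) auto

lemma mat_block_eq_zero:
  "(\<And>k l. i \<le> k \<Longrightarrow> k < i + p \<Longrightarrow> j \<le> l \<Longrightarrow> l < j + q \<Longrightarrow> M $$ (k, l) = 0) \<Longrightarrow>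
    mat_block M i j p q = 0\<^sub>m p q"
  by (rule eq_matI) auto

lemma four_block_mat_block:
  assumes "M \<in> carrier_mat (p1 + p2) (q1 + q2)"
  shows "M = four_block_mat (mat_block M 0 0 p1 q1) (mat_block M 0 q1 p1 q2)
    (mat_block M p1 0 p2 q1) (mat_block M p1 q1 p2 q2)"
  by (rule eq_matI) (use assms in auto)

lemma four_block_mat_block_consecutive:
  "four_block_mat (mat_block M i j p1 q1) (mat_block M i (j + q1) p1 q2)
    (mat_block M (i + p1) j p2 q1) (mat_block M (i + p1) (j + q1) p2 q2) =
    mat_block M i j (p1 + p2) (q1 + q2)"
  by (rule eq_matI) (auto simp: algebra_simps)

lemma mat_block_four_block:
  assumes "A \<in> carrier_mat p1 q1" "B \<in> carrier_mat p1 q2" "C \<in> carrier_mat p2 q1" "D \<in> carrier_mat p2 q2"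
  shows "mat_block (four_block_mat A B C D) 0 0 p1 q1 = A"
    "mat_block (four_block_mat A B C D) 0 q1 p1 q2 = B"
    "mat_block (four_block_mat A B C D) p1 0 p2 q1 = C"
    "mat_block (four_block_mat A B C D) p1 q1 p2 q2 = D"
  by (rule eq_matI, use assms in auto)+

lemma sum_supported_on_interval:
  fixes f :: "nat \<Rightarrow> 'a :: comm_monoid_add"
  assumes "i + p \<le> n" and "\<And>k. k < n \<Longrightarrow> k < i \<or> i + p \<le> k \<Longrightarrow> f k = 0"
  shows "(\<Sum>k = 0..<n. f k) = (\<Sum>a = 0..<p. f (i + a))"
proof -
  have "(\<Sum>k = 0..<n. f k) = (\<Sum>k = i..<i + p. f k)"
    by (rule sum.mono_neutral_right) (use assms in auto)
  also have "\<dots> = (\<Sum>a = 0..<p. f (i + a))"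
    using sum.shift_bounds_nat_ivl[of f 0 i p] by (simp add: add.commute)
  finally show ?thesis .
qed

text \<open>Every term of the inner sum outside \<open>[l, l + s)\<close> has a zero factor, so the
  sum shortens to that interval. The support condition covers plain products as well as the cut-off
  caused by a triangular factor.\<close>

lemma mat_block_mult_supported:
  fixes X :: "'a :: comm_semiring_0 mat"
  assumes X: "X \<in> carrier_mat r n" and Y: "Y \<in> carrier_mat n c"
    and le: "i + p \<le> r" "l + s \<le> n" "j + q \<le> c"
    and zero: "\<And>a k b. i \<le> a \<Longrightarrow> a < i + p \<Longrightarrow> j \<le> b \<Longrightarrow> b < j + q \<Longrightarrow> k < n \<Longrightarrow>
      k < l \<or> l + s \<le> k \<Longrightarrow> X $$ (a, k) = 0 \<or> Y $$ (k, b) = 0"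
  shows "mat_block (X * Y) i j p q = mat_block X i l p s * mat_block Y l j s q"
proof (rule eq_matI)
  fix a b assume "a < dim_row (mat_block X i l p s * mat_block Y l j s q)"
    "b < dim_col (mat_block X i l p s * mat_block Y l j s q)"
  hence ab: "a < p" "b < q" by auto
  have "(X * Y) $$ (i + a, j + b) = (\<Sum>k = 0..<n. X $$ (i + a, k) * Y $$ (k, j + b))"
    using X Y ab le by (simp add: scalar_prod_def)
  also have "\<dots> = (\<Sum>k = 0..<s. X $$ (i + a, l + k) * Y $$ (l + k, j + b))"
    proof (rule sum_supported_on_interval[OF le(2)])
    fix k assume "k < n" "k < l \<or> l + s \<le> k"
    thus "X $$ (i + a, k) * Y $$ (k, j + b) = 0"
      using zero[of "i + a" "j + b" k] ab by auto
  qed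
  finally show "mat_block (X * Y) i j p q $$ (a, b) = (mat_block X i l p s * mat_block Y l j s q) $$ (a, b)"
    using ab by (simp add: scalar_prod_def)
qed auto

lemma mat_block_mult:
  fixes X :: "'a :: comm_semiring_0 mat"
  assumes "X \<in> carrier_mat r n" "Y \<in> carrier_mat n c" "i + p \<le> r" "j + q \<le> c"
  shows "mat_block (X * Y) i j p q = mat_block X i 0 p n * mat_block Y 0 j n q"
  using assms by (intro mat_block_mult_supported) auto

lemma mat_block_full: "M \<in> carrier_mat p q \<Longrightarrow> mat_block M 0 0 p q = M"
  by (rule eq_matI) auto

section \<open>Congruence transformations\<close>

lemma dsum_congruence:
  assumes M: "M \<in> carrier_mat (p1 + p2) (q1 + q2)"
    and X: "X \<in> carrier_mat p1 p1" and Y: "Y \<in> carrier_mat p2 p2"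
    and X': "X' \<in> carrier_mat q1 q1" and Y': "Y' \<in> carrier_mat q2 q2"
  shows "(dsum X Y)\<^sup>T * M * dsum X' Y' =
    four_block_mat (X\<^sup>T * mat_block M 0 0 p1 q1 * X') (X\<^sup>T * mat_block M 0 q1 p1 q2 * Y')
      (Y\<^sup>T * mat_block M p1 0 p2 q1 * X') (Y\<^sup>T * mat_block M p1 q1 p2 q2 * Y')"
proof -
  have XT: "X\<^sup>T \<in> carrier_mat p1 p1" and YT: "Y\<^sup>T \<in> carrier_mat p2 p2" using X Y by auto
  have "(dsum X Y)\<^sup>T * M = four_block_mat (X\<^sup>T * mat_block M 0 0 p1 q1) (X\<^sup>T * mat_block M 0 q1 p1 q2)
      (Y\<^sup>T * mat_block M p1 0 p2 q1) (Y\<^sup>T * mat_block M p1 q1 p2 q2)"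
    unfolding transpose_dsum
    by (subst four_block_mat_block[OF M], rule dsum_mult_four_block[OF XT YT]) auto
  thus ?thesis
    using XT YT by (simp, intro four_block_mult_dsum[OF X' Y']) auto
qed

lemma congruence_mult:
  fixes M :: "'a :: comm_semiring_1 mat"
  assumes "X \<in> carrier_mat p p1" "Y \<in> carrier_mat p1 p2" "M \<in> carrier_mat p q"
    "X' \<in> carrier_mat q q1" "Y' \<in> carrier_mat q1 q2"
  shows "(X * Y)\<^sup>T * M * (X' * Y') = Y\<^sup>T * (X\<^sup>T * M * X') * Y'"
proof -
  have "(X * Y)\<^sup>T * M * (X' * Y') = Y\<^sup>T * (X\<^sup>T * (M * (X' * Y')))"
    using assms by (simp add: transpose_mult[of X p p1 Y p2] assoc_mult_mat[of _ p2 p1 _ p _ q]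
        assoc_mult_mat[of _ p2 p1 _ q _ q2] assoc_mult_mat[of _ p2 p1 _ p _ q2] assoc_mult_mat[of _ p1 p _ q _ q2])
  also have "\<dots> = Y\<^sup>T * (X\<^sup>T * M * X') * Y'"
    using assms by (simp add: assoc_mult_mat[of _ p2 p1 _ q1 _ q2] assoc_mult_mat[of _ p1 p _ q _ q1]
        assoc_mult_mat[of _ p1 p _ q1 _ q2] assoc_mult_mat[of _ p q _ q1 _ q2])
  finally show ?thesis .
qed

lemma congruence_quadratic_form:
  fixes M :: "'a :: comm_semiring_1 mat"
  assumes "M \<in> carrier_mat n n" "V \<in> carrier_mat n p" "x \<in> carrier_vec p"
  shows "x \<bullet> ((V\<^sup>T * M * V) *\<^sub>v x) = (V *\<^sub>v x) \<bullet> (M *\<^sub>v (V *\<^sub>v x))"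
proof -
  have "x \<bullet> ((V\<^sup>T * M * V) *\<^sub>v x) = x \<bullet> (V\<^sup>T *\<^sub>v (M *\<^sub>v (V *\<^sub>v x)))"
    using assms by (simp add: assoc_mult_mat_vec[of _ p n _ p] assoc_mult_mat_vec[of _ p n _ n])
  also have "\<dots> = (V\<^sup>T *\<^sub>v (M *\<^sub>v (V *\<^sub>v x))) \<bullet> x"
    using assms by (intro comm_scalar_prod) auto
  also have "\<dots> = (M *\<^sub>v (V *\<^sub>v x)) \<bullet> (V *\<^sub>v x)"
    using assms by (intro transpose_vec_mult_scalar) auto
  also have "\<dots> = (V *\<^sub>v x) \<bullet> (M *\<^sub>v (V *\<^sub>v x))"
    using assms by (intro comm_scalar_prod[of _ n]) auto
  finally show ?thesis .
qed

text \<open>Extension by zeros turns the form of a principal block into the form of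
  \<open>M\<close>, so sign conditions pass to principal blocks. The implication records that the
  extension is injective, which nonsingularity arguments use.\<close>

lemma mat_block_quadratic_form:
  fixes M :: "'a :: comm_semiring_1 mat"
  assumes M: "M \<in> carrier_mat n n" and le: "i + p \<le> n" and x: "x \<in> carrier_vec p"
  shows "\<exists>y \<in> carrier_vec n. y \<bullet> (M *\<^sub>v y) = x \<bullet> (mat_block M i i p p *\<^sub>v x) \<and>
    (y = 0\<^sub>v n \<longrightarrow> x = 0\<^sub>v p)"
proof -
  define y where "y = vec n (\<lambda>k. if i \<le> k \<and> k < i + p then x $ (k - i) else 0)"
  have y: "y \<in> carrier_vec n" by (simp add: y_def)
  have *: "(\<Sum>k = 0..<n. y $ k * f k) = (\<Sum>a = 0..<p. x $ a * f (i + a))" for f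
  proof -
    have "(\<Sum>k = 0..<n. y $ k * f k) = (\<Sum>a = 0..<p. y $ (i + a) * f (i + a))"
      by (rule sum_supported_on_interval) (use le in \<open>auto simp: y_def\<close>)
    thus ?thesis using le by (simp add: y_def)
  qed
  have "(M *\<^sub>v y) $ (i + a) = (mat_block M i i p p *\<^sub>v x) $ a" if "a < p" for a
  proof -
    have "(M *\<^sub>v y) $ (i + a) = (\<Sum>k = 0..<n. y $ k * M $$ (i + a, k))"
      using that le M by (simp add: scalar_prod_def y_def mult.commute)
    thus ?thesis using that x by (simp add: * scalar_prod_def mult.commute)
  qed
  hence "y \<bullet> (M *\<^sub>v y) = x \<bullet> (mat_block M i i p p *\<^sub>v x)"
    using M by (simp add: scalar_prod_def[of y] scalar_prod_def[of x] * del: index_mult_mat_vec)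
  moreover have "x = 0\<^sub>v p" if y0: "y = 0\<^sub>v n"
  proof (rule eq_vecI)
    fix a assume "a < dim_vec (0\<^sub>v p :: 'a vec)"
    hence a: "a < p" by simp
    have "y $ (i + a) = 0" using y0 a le by simp
    thus "x $ a = 0\<^sub>v p $ a" using a le by (simp add: y_def)
  qed (use x in simp)
  ultimately show ?thesis using y by blast
qed

text \<open>Moving from \<open>x\<close> along \<open>y\<close>, the image of \<open>x\<close> under
  \<open>S\<close>, changes the form to \<open>2 * t * a + t * t * c\<close> with \<open>a\<close>
  the squared length of \<open>y\<close>. A suitable negative \<open>t\<close> makes this negative
  unless \<open>a = 0\<close>.\<close>

lemma psd_kernel:
  fixes S :: "real mat"
  assumes S: "S \<in> carrier_mat n n" and sym: "S\<^sup>T = S"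
    and psd: "\<And>x. x \<in> carrier_vec n \<Longrightarrow> 0 \<le> x \<bullet> (S *\<^sub>v x)"
    and x: "x \<in> carrier_vec n" "x \<bullet> (S *\<^sub>v x) = 0"
  shows "S *\<^sub>v x = 0\<^sub>v n"
proof -
  define y where "y = S *\<^sub>v x"
  \<comment> \<open>The denominator \<open>c + 1\<close> is positive even for \<open>c = 0\<close>.
    After multiplication by its square the form takes the value
    \<open>- a\<^sup>2 * (c + 2)\<close>.\<close>
  define a c t where "a = y \<bullet> y" and "c = y \<bullet> (S *\<^sub>v y)" and "t = - (a / (c + 1))"
  have y: "y \<in> carrier_vec n" using S x by (simp add: y_def)
  have a0: "a \<ge> 0" and c0: "c \<ge> 0" using psd[OF y] conjugate_square_ge_0_vec[of y] by (auto simp: a_def c_def)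
  have xy: "x \<bullet> (S *\<^sub>v y) = a"
    using transpose_vec_mult_scalar[OF S y x(1)] sym comm_scalar_prod[OF x(1), of "S *\<^sub>v y"] S x y
      comm_scalar_prod[of "S *\<^sub>v y" n x] comm_scalar_prod[of y n "S *\<^sub>v x"]
    by (metis a_def mult_mat_vec_carrier transpose_vec_mult_scalar y_def)
  have "(x + t \<cdot>\<^sub>v y) \<bullet> (S *\<^sub>v (x + t \<cdot>\<^sub>v y)) = 2 * t * a + t * t * c"
    using S x y xy by (simp add: mult_add_distrib_mat_vec[of _ n n] mult_mat_vec add_scalar_prod_distrib[of _ n]
        scalar_prod_add_distrib[of _ n] y_def[symmetric] a_def[symmetric] c_def[symmetric] algebra_simps)
  hence "0 \<le> 2 * t * a + t * t * c"
    using psd[of "x + t \<cdot>\<^sub>v y"] x y by simp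
  hence "0 \<le> (2 * t * a + t * t * c) * (c + 1)\<^sup>2" by simp
  also have "\<dots> = - (a\<^sup>2 * (c + 2))"
    using c0 by (simp add: t_def power2_eq_square divide_simps) (simp add: algebra_simps)
  finally have "a\<^sup>2 * (c + 2) \<le> 0" by simp
  hence "a = 0" using c0 by (simp add: mult_le_0_iff)
  thus ?thesis using conjugate_square_eq_0_vec[OF y] by (simp add: a_def y_def)
qed

text \<open>A kernel vector of the block extends by zeros to a vector on which the form of
  \<open>S\<close> vanishes; it lies in the kernel of \<open>S\<close> by semidefiniteness and is
  therefore zero.\<close>

lemma psd_nonsingular_principal_block:
  fixes S :: "real mat"
  assumes S: "S \<in> carrier_mat n n" and sym: "S\<^sup>T = S"
    and psd: "\<And>x. x \<in> carrier_vec n \<Longrightarrow> 0 \<le> x \<bullet> (S *\<^sub>v x)"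
    and det: "det S \<noteq> 0" and le: "i + p \<le> n"
  shows "det (mat_block S i i p p) \<noteq> 0"
proof -
  have "x = 0\<^sub>v p" if x: "x \<in> carrier_vec p" "mat_block S i i p p *\<^sub>v x = 0\<^sub>v p" for x
  proof -
    obtain y where y: "y \<in> carrier_vec n" "y \<bullet> (S *\<^sub>v y) = 0" "y = 0\<^sub>v n \<longrightarrow> x = 0\<^sub>v p"
      using mat_block_quadratic_form[OF S le x(1)] x by auto
    thus ?thesis using psd_kernel[OF S sym psd y(1,2)] det det_nonzero_iff_injective[OF S] by blast
  qed
  thus ?thesis using det_nonzero_iff_injective[of _ p] by (metis mat_block_carrier)
qed

text \<open>The negated symmetric part is positive semidefinite and its form vanishes on any kernel
  vector of \<open>M\<close>. Hence it annihilates that vector, and so does the transpose.\<close>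

lemma dissipative_kernel_transpose:
  fixes M :: "real mat"
  assumes M: "M \<in> carrier_mat n n"
    and diss: "\<And>x. x \<in> carrier_vec n \<Longrightarrow> x \<bullet> (M *\<^sub>v x) \<le> 0"
    and x: "x \<in> carrier_vec n"
  shows "M *\<^sub>v x = 0\<^sub>v n \<longleftrightarrow> M\<^sup>T *\<^sub>v x = 0\<^sub>v n"
proof -
  have quadT: "y \<bullet> (M\<^sup>T *\<^sub>v y) = y \<bullet> (M *\<^sub>v y)" if "y \<in> carrier_vec n" for y
    using that M transpose_vec_mult_scalar[OF M that that] comm_scalar_prod[OF that, of "M\<^sup>T *\<^sub>v y"]
      comm_scalar_prod[OF that, of "M *\<^sub>v y"] by simp
  \<comment> \<open>Stated for a general \<open>N\<close>, so that \<open>M\<close> gives one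
    direction and its transpose the other.\<close>
  have "N\<^sup>T *\<^sub>v x = 0\<^sub>v n" if N: "N \<in> carrier_mat n n" "N *\<^sub>v x = 0\<^sub>v n"
    and NT: "\<And>y. y \<in> carrier_vec n \<Longrightarrow> y \<bullet> (N *\<^sub>v y) \<le> 0"
      "\<And>y. y \<in> carrier_vec n \<Longrightarrow> y \<bullet> (N\<^sup>T *\<^sub>v y) = y \<bullet> (N *\<^sub>v y)" for N
  proof -
    define S where "S = - (N + N\<^sup>T)"
    have S: "S \<in> carrier_mat n n" using N by (simp add: S_def)
    have Sv: "S *\<^sub>v y = - (N *\<^sub>v y + N\<^sup>T *\<^sub>v y)" if "y \<in> carrier_vec n" for y
      using N that by (simp add: S_def add_mult_distrib_mat_vec[of _ n n])
    have quad: "y \<bullet> (S *\<^sub>v y) = - 2 * (y \<bullet> (N *\<^sub>v y))" if "y \<in> carrier_vec n" for y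
      using N NT(2)[OF that] that by (simp add: Sv scalar_prod_add_distrib[of _ n])
    have "S *\<^sub>v x = 0\<^sub>v n"
    proof (rule psd_kernel[OF S _ _ x])
      show "S\<^sup>T = S" by (rule eq_matI) (use N in \<open>auto simp: S_def\<close>)
    qed (use quad NT(1) N x in auto)
    hence "- (N\<^sup>T *\<^sub>v x) = 0\<^sub>v n"
      using Sv[OF x] N x by simp
    thus ?thesis using N x by (metis uminus_uminus_vec uminus_zero_vec)
  qed
  from this[of M] this[of "M\<^sup>T"] show ?thesis using M diss quadT by auto
qed

subsection \<open>Simultaneous reduction\<close>

text \<open>Four compressions are carried out in turn, each acting inside the blocks left by the
  earlier ones, so that earlier zero patterns persist. Applied with \<open>Q\<^sup>T * E\<close> and
  \<open>Q\<^sup>T * A\<close> for \<open>S\<close> and \<open>A\<close>. Blocks with zero rows in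
  the conclusion only express horizontal concatenation.\<close>

lemma congruence_psd_staircase:
  fixes S A C :: "real mat"
  assumes S: "S \<in> carrier_mat n n" and A: "A \<in> carrier_mat n n" and C: "C \<in> carrier_mat m n"
    and sym: "S\<^sup>T = S"
    and psd: "\<And>x. x \<in> carrier_vec n \<Longrightarrow> 0 \<le> x \<bullet> (S *\<^sub>v x)"
    and diss: "\<And>x. x \<in> carrier_vec n \<Longrightarrow> x \<bullet> (A *\<^sub>v x) \<le> 0"
  shows "\<exists>n1 n2 n3 n4 n5 m1 V W E0 C11 C1 C33 A44.
    n1 + n2 + n3 + n4 + n5 = n \<and> n1 + m1 + n3 = m \<and> orthonormal_mat n V \<and> orthonormal_mat m W \<and>
    E0 \<in> carrier_mat (n1 + n2) (n1 + n2) \<and> det E0 \<noteq> 0 \<and>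
    C11 \<in> carrier_mat n1 n1 \<and> det C11 \<noteq> 0 \<and> C1 \<in> carrier_mat n3 (n1 + n2) \<and>
    C33 \<in> carrier_mat n3 n3 \<and> det C33 \<noteq> 0 \<and>
    A44 \<in> carrier_mat n4 n4 \<and> det A44 \<noteq> 0 \<and>
    V\<^sup>T * S * V = four_block_mat E0 (0\<^sub>m (n1 + n2) (n3 + n4 + n5)) (0\<^sub>m (n3 + n4 + n5) (n1 + n2))
      (0\<^sub>m (n3 + n4 + n5) (n3 + n4 + n5)) \<and>
    W\<^sup>T * C * V = four_block_mat
      (four_block_mat C11 (0\<^sub>m n1 n2) (0\<^sub>m m1 n1) (0\<^sub>m m1 n2)) (0\<^sub>m (n1 + m1) (n3 + n4 + n5))
      C1 (four_block_mat C33 (0\<^sub>m n3 (n4 + n5)) (0\<^sub>m 0 n3) (0\<^sub>m 0 (n4 + n5))) \<and>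
    mat_block (V\<^sup>T * A * V) (n1 + n2 + n3) (n1 + n2 + n3) (n4 + n5) (n4 + n5) =
      four_block_mat A44 (0\<^sub>m n4 n5) (0\<^sub>m n5 n4) (0\<^sub>m n5 n5)"
proof -
  \<comment> \<open>First compression: the last \<open>s\<close> coordinates span the kernel of
    \<open>S\<close>.\<close>
  obtain Va r s E0 where Va: "orthonormal_mat n Va" and n: "n = r + s"
    and E0: "E0 \<in> carrier_mat r r" "det E0 \<noteq> 0"
    and SVa: "Va\<^sup>T * S * Va = four_block_mat E0 (0\<^sub>m r s) (0\<^sub>m s r) (0\<^sub>m s s)"
    using ex_congruence_compression[OF S] sym by auto
  note va = orthonormal_matD(1)[OF Va]
  have CVa: "C * Va \<in> carrier_mat m (r + s)" using C va n by simp
  \<comment> \<open>Second compression: \<open>C\<close> restricted to the kernel of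
    \<open>S\<close>, with its rank \<open>k\<close> collected in the last \<open>k\<close>
    outputs.\<close>
  obtain Wb Vb k p q C33 where Wb: "orthonormal_mat m Wb" and Vb: "orthonormal_mat s Vb"
    and m: "m = p + k" and s: "s = k + q" and C33: "C33 \<in> carrier_mat k k" "det C33 \<noteq> 0"
    and eqb: "Wb\<^sup>T * mat_block (C * Va) 0 r m s * Vb = four_block_mat (0\<^sub>m p k) (0\<^sub>m p q) C33 (0\<^sub>m k q)"
    using ex_two_sided_compression_bottom[of "mat_block (C * Va) 0 r m s" m s] by auto
  note wb = orthonormal_matD(1)[OF Wb] and vb = orthonormal_matD(1)[OF Vb]
  define N where "N = Wb\<^sup>T * C * Va"
  have N: "N \<in> carrier_mat (p + k) (r + s)" using wb C va m n by (simp add: N_def)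
  \<comment> \<open>The columns of \<open>N\<close> over the kernel of \<open>S\<close>, for an
    arbitrary range of rows: the top \<open>p\<close> rows yield zero and the bottom
    \<open>k\<close> rows yield \<open>K\<close>.\<close>
  have Nright: "mat_block N i r l s * Vb = mat_block (four_block_mat (0\<^sub>m p k) (0\<^sub>m p q) C33 (0\<^sub>m k q)) i 0 l s"
    if "i + l \<le> m" for i l
  proof -
    have "mat_block N i r l s = mat_block Wb\<^sup>T i 0 l m * mat_block (C * Va) 0 r m s"
      unfolding N_def using that wb C va n m
      by (simp add: assoc_mult_mat[of _ m m _ n _ n] mat_block_mult[of _ m m _ n])
    hence "mat_block N i r l s * Vb = mat_block Wb\<^sup>T i 0 l m * (mat_block (C * Va) 0 r m s * Vb)"
      using vb by (simp add: assoc_mult_mat[of _ l m _ s _ s])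
    also have "\<dots> = mat_block Wb\<^sup>T i 0 l m * mat_block (mat_block (C * Va) 0 r m s * Vb) 0 0 m s"
      by (subst mat_block_full[of _ m s]) (use vb in \<open>auto intro: mult_carrier_mat[of _ _ s]\<close>)
    also have "\<dots> = mat_block (Wb\<^sup>T * (mat_block (C * Va) 0 r m s * Vb)) i 0 l s"
      using wb vb that by (intro mat_block_mult[symmetric]) auto
    also have "Wb\<^sup>T * (mat_block (C * Va) 0 r m s * Vb) = Wb\<^sup>T * mat_block (C * Va) 0 r m s * Vb"
      using wb vb by (simp add: assoc_mult_mat[of _ m m _ s _ s])
    finally show ?thesis unfolding eqb .
  qed
  define K where "K = four_block_mat C33 (0\<^sub>m k q) (0\<^sub>m 0 k) (0\<^sub>m 0 q)"
  have K: "K \<in> carrier_mat k s" using C33 s by (auto simp: K_def)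
  have N12: "mat_block N 0 r p s * Vb = 0\<^sub>m p s"
    unfolding Nright[of 0 p, unfolded m, simplified] using C33 s by (intro eq_matI) auto
  have N22: "mat_block N p r k s * Vb = K"
    unfolding Nright[of p k, unfolded m, simplified] K_def using C33 s by (intro eq_matI) auto
  \<comment> \<open>Third compression: the top \<open>p\<close> outputs vanish on the kernel of
    \<open>S\<close>, so only their part on the first \<open>r\<close> coordinates remains.\<close>
  obtain Wc Vc a p' r' C11 where Wc: "orthonormal_mat p Wc" and Vc: "orthonormal_mat r Vc"
    and p: "p = a + p'" and r: "r = a + r'" and C11: "C11 \<in> carrier_mat a a" "det C11 \<noteq> 0"
    and eqc: "Wc\<^sup>T * mat_block N 0 0 p r * Vc = four_block_mat C11 (0\<^sub>m a r') (0\<^sub>m p' a) (0\<^sub>m p' r')"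
    using ex_two_sided_compression[of "mat_block N 0 0 p r" p r] by auto
  note wc = orthonormal_matD(1)[OF Wc] and vc = orthonormal_matD(1)[OF Vc]
  define M where "M = Va\<^sup>T * A * Va"
  have M: "M \<in> carrier_mat (r + s) (r + s)" using va A n by (simp add: M_def)
  define M2 where "M2 = Vb\<^sup>T * mat_block M r r s s * Vb"
  have M2: "M2 \<in> carrier_mat (k + q) (k + q)" 
    using vb s by (auto simp: M2_def intro!: mult_carrier_mat[of _ _ "k + q"])
  \<comment> \<open>Extension by zeros and the changes of basis \<open>Vb\<close> and
    \<open>Va\<close> express this form as the form of \<open>A\<close> at one vector.\<close>
  have M2diss: "x \<bullet> (mat_block M2 k k q q *\<^sub>v x) \<le> 0" if x: "x \<in> carrier_vec q" for x
  proof -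
    obtain y where y: "y \<in> carrier_vec s" "y \<bullet> (M2 *\<^sub>v y) = x \<bullet> (mat_block M2 k k q q *\<^sub>v x)"
      using mat_block_quadratic_form[of M2 s k q x] M2 s x by auto
    have "Vb *\<^sub>v y \<in> carrier_vec s" using vb y by simp
    then obtain z where z: "z \<in> carrier_vec n"
      "z \<bullet> (M *\<^sub>v z) = (Vb *\<^sub>v y) \<bullet> (mat_block M r r s s *\<^sub>v (Vb *\<^sub>v y))"
      using mat_block_quadratic_form[of M n r s "Vb *\<^sub>v y"] M n by auto
    have "y \<bullet> (M2 *\<^sub>v y) = z \<bullet> (M *\<^sub>v z)"
      unfolding M2_def z(2) by (rule congruence_quadratic_form[of _ s]) (use vb y in auto)
    also have "\<dots> = (Va *\<^sub>v z) \<bullet> (A *\<^sub>v (Va *\<^sub>v z))"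
      unfolding M_def by (rule congruence_quadratic_form[OF A va z(1)])
    also have "\<dots> \<le> 0" using va z(1) by (intro diss) simp
    finally show ?thesis using y by simp
  qed
  \<comment> \<open>Fourth compression, on the part of the kernel of \<open>S\<close> where
    \<open>C\<close> vanishes: dissipativity identifies the two kernels, so a congruence
    suffices.\<close>
  obtain Vd a4 l A44 where Vd: "orthonormal_mat q Vd" and q: "q = a4 + l"
    and A44: "A44 \<in> carrier_mat a4 a4" "det A44 \<noteq> 0"
    and eqd: "Vd\<^sup>T * mat_block M2 k k q q * Vd = four_block_mat A44 (0\<^sub>m a4 l) (0\<^sub>m l a4) (0\<^sub>m l l)"
    using ex_congruence_compression[OF _ dissipative_kernel_transpose[OF _ M2diss]] by (metis mat_block_carrier)
  note vd = orthonormal_matD(1)[OF Vd]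
  define Ve where "Ve = dsum (1\<^sub>m k) Vd"
  have Ve: "orthonormal_mat s Ve"
    using orthonormal_mat_dsum[OF orthonormal_mat_one Vd] by (simp add: Ve_def s)
  note ve = orthonormal_matD(1)[OF Ve]
  \<comment> \<open>\<open>Ve\<close> is the identity on the coordinates of \<open>C33\<close> and
    mixes only zero columns of \<open>K\<close>.\<close>
  have KVe: "K * Ve = K"
    unfolding K_def Ve_def using C33 vd
    by (subst four_block_mult_dsum[of _ k _ q _ k _ _ 0]) auto
  define V where "V = Va * dsum Vc (Vb * Ve)"
  define W where "W = Wb * dsum Wc (1\<^sub>m k)"
  have VbVe: "orthonormal_mat s (Vb * Ve)" using orthonormal_mat_mult[OF Vb Ve] .
  have D: "orthonormal_mat n (dsum Vc (Vb * Ve))" using orthonormal_mat_dsum[OF Vc VbVe] n by simp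
  have F: "orthonormal_mat m (dsum Wc (1\<^sub>m k))" using orthonormal_mat_dsum[OF Wc orthonormal_mat_one] m by simp
  have V: "orthonormal_mat n V" and W: "orthonormal_mat m W"
    unfolding V_def W_def using orthonormal_mat_mult Va Wb D F by blast+
  note d = orthonormal_matD(1)[OF D] and f = orthonormal_matD(1)[OF F]
  have "V\<^sup>T * S * V = (dsum Vc (Vb * Ve))\<^sup>T * (Va\<^sup>T * S * Va) * dsum Vc (Vb * Ve)"
    unfolding V_def by (rule congruence_mult[OF va d S va d])
  also have "\<dots> = four_block_mat (Vc\<^sup>T * E0 * Vc) (0\<^sub>m r s) (0\<^sub>m s r) (0\<^sub>m s s)"
    unfolding SVa using E0(1) vc vb ve
    by (subst dsum_congruence[of _ r s r s])
      (simp_all add: mat_block_four_block[OF E0(1) zero_carrier_mat zero_carrier_mat zero_carrier_mat])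
  finally have 1: "V\<^sup>T * S * V = four_block_mat (Vc\<^sup>T * E0 * Vc) (0\<^sub>m r s) (0\<^sub>m s r) (0\<^sub>m s s)" .
  \<comment> \<open>\<open>Vc\<close> also acts on the block of \<open>S\<close>, but only by a
    congruence that keeps it nonsingular.\<close>
  have E0': "Vc\<^sup>T * E0 * Vc \<in> carrier_mat r r" "det (Vc\<^sup>T * E0 * Vc) \<noteq> 0"
    using E0 vc orthonormal_mat_det[OF Vc] by (simp_all add: det_mult[of _ r] det_transpose[of _ r])
  have "W\<^sup>T * C * V = (dsum Wc (1\<^sub>m k))\<^sup>T * N * dsum Vc (Vb * Ve)"
    unfolding V_def W_def N_def by (rule congruence_mult[OF wb f C va d])
  also have "\<dots> = four_block_mat (Wc\<^sup>T * mat_block N 0 0 p r * Vc) (Wc\<^sup>T * mat_block N 0 r p s * (Vb * Ve))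
      ((1\<^sub>m k)\<^sup>T * mat_block N p 0 k r * Vc) ((1\<^sub>m k)\<^sup>T * mat_block N p r k s * (Vb * Ve))"
    by (rule dsum_congruence[OF N]) (use wc vc vb ve in auto)
  also have "Wc\<^sup>T * mat_block N 0 r p s * (Vb * Ve) = Wc\<^sup>T * ((mat_block N 0 r p s * Vb) * Ve)"
    using wc vb ve by (simp add: assoc_mult_mat[of _ p p _ s _ s] assoc_mult_mat[of _ p s _ s _ s])
  also have "\<dots> = 0\<^sub>m p s" unfolding N12 using wc ve by simp
  also have "(1\<^sub>m k)\<^sup>T * mat_block N p r k s * (Vb * Ve) = (mat_block N p r k s * Vb) * Ve"
    using vb ve by (simp add: assoc_mult_mat[of _ k s _ s _ s])
  also have "\<dots> = K" unfolding N22 by (rule KVe)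
  finally have 2: "W\<^sup>T * C * V = four_block_mat (four_block_mat C11 (0\<^sub>m a r') (0\<^sub>m p' a) (0\<^sub>m p' r')) (0\<^sub>m p s)
      (mat_block N p 0 k r * Vc) K"
    unfolding eqc by simp
  have "V\<^sup>T * A * V = (dsum Vc (Vb * Ve))\<^sup>T * M * dsum Vc (Vb * Ve)"
    unfolding V_def M_def by (rule congruence_mult[OF va d A va d])
  also have "\<dots> = four_block_mat (Vc\<^sup>T * mat_block M 0 0 r r * Vc) (Vc\<^sup>T * mat_block M 0 r r s * (Vb * Ve))
      ((Vb * Ve)\<^sup>T * mat_block M r 0 s r * Vc) ((Vb * Ve)\<^sup>T * mat_block M r r s s * (Vb * Ve))"
    by (rule dsum_congruence[OF M]) (use vc vb ve in auto)
  finally have eqA: "V\<^sup>T * A * V = \<dots>" .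
  have "mat_block (V\<^sup>T * A * V) r r s s = (Vb * Ve)\<^sup>T * mat_block M r r s s * (Vb * Ve)"
    unfolding eqA by (rule mat_block_four_block(4)) (rule carrier_matI, use vc vb ve in simp, use vc vb ve in simp)+
  also have "\<dots> = Ve\<^sup>T * M2 * Ve"
    unfolding M2_def by (rule congruence_mult[OF vb ve _ vb ve]) simp
  also have "\<dots> = four_block_mat ((1\<^sub>m k)\<^sup>T * mat_block M2 0 0 k k * 1\<^sub>m k) ((1\<^sub>m k)\<^sup>T * mat_block M2 0 k k q * Vd)
      (Vd\<^sup>T * mat_block M2 k 0 q k * 1\<^sub>m k) (Vd\<^sup>T * mat_block M2 k k q q * Vd)"
    unfolding Ve_def by (rule dsum_congruence[OF M2]) (use vd in auto)
  finally have eqA2: "mat_block (V\<^sup>T * A * V) r r s s = \<dots>" .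
  have "mat_block (mat_block (V\<^sup>T * A * V) r r s s) k k q q = Vd\<^sup>T * mat_block M2 k k q q * Vd"
    unfolding eqA2 by (rule mat_block_four_block(4)) (rule carrier_matI, use vd in simp, use vd in simp)+
  hence 3: "mat_block (V\<^sup>T * A * V) (r + k) (r + k) q q = four_block_mat A44 (0\<^sub>m a4 l) (0\<^sub>m l a4) (0\<^sub>m l l)"
    using s by (simp add: mat_block_mat_block eqd)
  define E1 C1 where "E1 = Vc\<^sup>T * E0 * Vc" and "C1 = mat_block N p 0 k r * Vc"
  have C1: "C1 \<in> carrier_mat k r"
    unfolding C1_def by (rule mult_carrier_mat[OF mat_block_carrier vc])
  have s': "s = k + a4 + l" using s q by simp
  have nm: "a + r' + k + a4 + l = n" "a + p' + k = m" using n m p r s q by simp_all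
  note facts = E0'[folded E1_def] C1 1[folded E1_def] 2[folded C1_def, unfolded K_def] 3
  \<comment> \<open>The sizes \<open>n1\<close> to \<open>n5\<close> are \<open>a\<close>,
    \<open>r'\<close>, \<open>k\<close>, \<open>a4\<close>, \<open>l\<close>, and \<open>m1\<close>
    is \<open>p'\<close>.\<close>
  show ?thesis
    by (rule exI[of _ a], rule exI[of _ r'], rule exI[of _ k], rule exI[of _ a4], rule exI[of _ l],
        rule exI[of _ p'], rule exI[of _ V], rule exI[of _ W], rule exI[of _ E1], rule exI[of _ C11],
        rule exI[of _ C1], rule exI[of _ C33], rule exI[of _ A44], intro conjI)
      (fact nm V W C11 C33 A44 facts[unfolded p r s' q])+
qed

text \<open>Householder QR: a reflection clears the first column below the diagonal, and the
  induction hypothesis treats the trailing block without disturbing that column.\<close>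

lemma ex_orthonormal_mult_upper_triangular:
  fixes M :: "real mat"
  assumes "M \<in> carrier_mat n n"
  shows "\<exists>U. orthonormal_mat n U \<and> upper_triangular (U * M)"
  using assms
proof (induction n arbitrary: M)
  case 0
  thus ?case using orthonormal_mat_one[of 0] by (intro exI[of _ "1\<^sub>m 0"]) auto
next
  case (Suc k M)
  obtain H c where H: "orthonormal_mat (Suc k) H" and Hc: "H *\<^sub>v col M 0 = c \<cdot>\<^sub>v unit_vec (Suc k) 0"
    using ex_orthonormal_mat_maps_to_axis[of "col M 0" "Suc k" 0] Suc.prems by auto
  note h = orthonormal_matD(1)[OF H]
  have HM: "H * M \<in> carrier_mat (1 + k) (1 + k)" using h Suc.prems by simp
  have col0: "(H * M) $$ (i, 0) = 0" if "0 < i" "i < Suc k" for i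
  proof -
    have "(H * M) $$ (i, 0) = (H *\<^sub>v col M 0) $ i" using that h Suc.prems by simp
    thus ?thesis using that by (simp add: Hc)
  qed
  obtain U where U: "orthonormal_mat k U" and ut: "upper_triangular (U * mat_block (H * M) 1 1 k k)"
    using Suc.IH[of "mat_block (H * M) 1 1 k k"] by auto
  note u = orthonormal_matD(1)[OF U]
  define D where "D = dsum (1\<^sub>m 1) U"
  have D: "orthonormal_mat (Suc k) D"
    using orthonormal_mat_dsum[OF orthonormal_mat_one U, of 1] by (simp add: D_def)
  have "(D * H) * M = D * (H * M)"
    using orthonormal_matD(1)[OF D] h Suc.prems by simp
  also have "\<dots> = four_block_mat (1\<^sub>m 1 * mat_block (H * M) 0 0 1 1) (1\<^sub>m 1 * mat_block (H * M) 0 1 1 k)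
      (U * mat_block (H * M) 1 0 k 1) (U * mat_block (H * M) 1 1 k k)"
    unfolding D_def by (subst four_block_mat_block[OF HM], rule dsum_mult_four_block) (use u in auto)
  also have "mat_block (H * M) 1 0 k 1 = 0\<^sub>m k 1"
    by (rule mat_block_eq_zero) (use col0 in auto)
  finally have "upper_triangular ((D * H) * M)"
    using ut u by (auto simp: upper_triangular_def less_Suc_eq_0_disj)
  thus ?case using orthonormal_mat_mult[OF D H] by blast
qed

section \<open>Left multiplication by an upper triangular matrix\<close>

lemma upper_triangular_det_diag_block:
  fixes T :: "'a :: idom mat"
  assumes T: "T \<in> carrier_mat n n" "upper_triangular T" "det T \<noteq> 0" and le: "i + p \<le> n"
  shows "det (mat_block T i i p p) \<noteq> 0"
proof -
  have diag: "T $$ (k, k) \<noteq> 0" if "k < n" for k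
    using T that det_upper_triangular[OF T(2,1)] by (auto simp: prod_list_zero_iff diag_mat_def)
  have "upper_triangular (mat_block T i i p p)"
    using T le by (auto simp: upper_triangular_def)
  from det_upper_triangular[OF this mat_block_carrier] show ?thesis
    using diag le by (auto simp: prod_list_zero_iff diag_mat_def)
qed

text \<open>Row \<open>i\<close> of \<open>T\<close> sees only the rows of \<open>M\<close> from
  \<open>i\<close> on, so zeros that reach the bottom of a column survive.\<close>

lemma upper_triangular_mult_eq_zero:
  fixes T :: "'a :: semiring_0 mat"
  assumes T: "T \<in> carrier_mat n n" "upper_triangular T" and M: "M \<in> carrier_mat n q"
    and ij: "i < n" "j < q" and zero: "\<And>k. i \<le> k \<Longrightarrow> k < n \<Longrightarrow> M $$ (k, j) = 0"
  shows "(T * M) $$ (i, j) = 0"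
proof -
  have "(T * M) $$ (i, j) = (\<Sum>k = 0..<n. T $$ (i, k) * M $$ (k, j))"
    using T M ij by (simp add: scalar_prod_def)
  also have "T $$ (i, k) * M $$ (k, j) = 0" if "k < n" for k
    using T(2) zero[of k] ij that T(1) by (cases "k < i") (auto simp: upper_triangular_def)
  hence "(\<Sum>k = 0..<n. T $$ (i, k) * M $$ (k, j)) = 0" by simp
  finally show ?thesis .
qed

text \<open>Triangularity removes the inner indices below \<open>i\<close> and the zeros of
  \<open>M\<close> those from \<open>i + p\<close> on. The block is thus a diagonal block of
  \<open>T\<close> times the block of \<open>M\<close>, and both are nonsingular.\<close>

lemma upper_triangular_mult_det_block:
  fixes T :: "'a :: idom mat"
  assumes T: "T \<in> carrier_mat n n" "upper_triangular T" "det T \<noteq> 0" and M: "M \<in> carrier_mat n q"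
    and le: "i + p \<le> n" "j + p \<le> q"
    and zero: "\<And>k l. i + p \<le> k \<Longrightarrow> k < n \<Longrightarrow> j \<le> l \<Longrightarrow> l < j + p \<Longrightarrow> M $$ (k, l) = 0"
    and det: "det (mat_block M i j p p) \<noteq> 0"
  shows "det (mat_block (T * M) i j p p) \<noteq> 0"
proof -
  have "mat_block (T * M) i j p p = mat_block T i i p p * mat_block M i j p p"
    by (rule mat_block_mult_supported[OF T(1) M le(1) le(1) le(2)])
      (use T(1,2) le zero in \<open>auto simp: upper_triangular_def\<close>)
  thus ?thesis
    using det upper_triangular_det_diag_block[OF T le(1)] by (simp add: det_mult[of _ p])
qed

subsection \<open>Port-Hamiltonian systems\<close>

lemma mat_block_append_cols:
  "mat_block M i j p (q1 + q2) = mat_block M i j p q1 @\<^sub>c mat_block M i (j + q1) p q2"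
  by (rule eq_matI) (auto simp: append_cols_def)

lemma mat_block_append_rows:
  "mat_block M i j (p1 + p2) q = mat_block M i j p1 q @\<^sub>r mat_block M (i + p1) j p2 q"
  by (rule eq_matI) (auto simp: append_rows_def)

lemma mat_block_append_cols3:
  "mat_block M i 0 p (q1 + q2 + q3) =
    mat_block M i 0 p q1 @\<^sub>c mat_block M i q1 p q2 @\<^sub>c mat_block M i (q1 + q2) p q3"
  by (simp add: add.assoc mat_block_append_cols)

lemma mat_block_append_rows3:
  "mat_block M 0 j (p1 + p2 + p3) q =
    mat_block M 0 j p1 q @\<^sub>r mat_block M p1 j p2 q @\<^sub>r mat_block M (p1 + p2) j p3 q"
  by (simp add: add.assoc mat_block_append_rows)

lemma mat_block_append_cols5:
  "mat_block M i 0 p (q1 + q2 + q3 + q4 + q5) =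
    mat_block M i 0 p q1 @\<^sub>c mat_block M i q1 p q2 @\<^sub>c mat_block M i (q1 + q2) p q3 @\<^sub>c
    mat_block M i (q1 + q2 + q3) p q4 @\<^sub>c mat_block M i (q1 + q2 + q3 + q4) p q5"
  by (simp add: add.assoc mat_block_append_cols)

lemma mat_block_append_rows5:
  "mat_block M 0 j (p1 + p2 + p3 + p4 + p5) q =
    mat_block M 0 j p1 q @\<^sub>r mat_block M p1 j p2 q @\<^sub>r mat_block M (p1 + p2) j p3 q @\<^sub>r
    mat_block M (p1 + p2 + p3) j p4 q @\<^sub>r mat_block M (p1 + p2 + p3 + p4) j p5 q"
  by (simp add: add.assoc mat_block_append_rows)

lemma mat_rank_eq_dim: "M \<in> carrier_mat k k \<Longrightarrow> det M \<noteq> 0 \<Longrightarrow> mat_rank M = k"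
  using vec_space.det_rank_iff[of M k] by auto

lemma skew_quadratic_form_eq_0:
  fixes K :: "real mat"
  assumes K: "K \<in> carrier_mat n n" "K = - K\<^sup>T" and x: "x \<in> carrier_vec n"
  shows "x \<bullet> (K *\<^sub>v x) = 0"
proof -
  have "K *\<^sub>v x = - (K\<^sup>T *\<^sub>v x)"
    using K(1) x by (subst K(2)) simp
  hence "x \<bullet> (K *\<^sub>v x) = - (x \<bullet> (K\<^sup>T *\<^sub>v x))"
    using K(1) x by simp
  also have "x \<bullet> (K\<^sup>T *\<^sub>v x) = (K\<^sup>T *\<^sub>v x) \<bullet> x"
    using K(1) x by (intro comm_scalar_prod[of _ n]) auto
  also have "\<dots> = x \<bullet> (K *\<^sub>v x)"
    using K(1) x by (intro transpose_vec_mult_scalar) auto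
  finally show ?thesis by simp
qed

text \<open>Cancelling \<open>Q\<^sup>T\<close> in \<open>Q\<^sup>T * P = 0\<close> gives
  \<open>P = 0\<close>, so \<open>B = G\<close> and \<open>C = B\<^sup>T * Q\<close>. Dissipativity
  holds because \<open>Q\<^sup>T * A\<close> is a skew matrix minus a positive semidefinite one.
  \<open>K\<close> is the inverse of \<open>Q\<^sup>T\<close>.\<close>

lemma pH_representation_nonsingular:
  assumes ph: "pH_representation n m E A B C J R Q G P" and inv: "invertible_mat Q"
    and dims: "E \<in> carrier_mat n n" "A \<in> carrier_mat n n" "B \<in> carrier_mat n m"
  obtains K where "Q \<in> carrier_mat n n" "K \<in> carrier_mat n n" "K * Q\<^sup>T = 1\<^sub>m n" "det K \<noteq> 0" "C\<^sup>T = Q\<^sup>T * B"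
    "(Q\<^sup>T * E)\<^sup>T = Q\<^sup>T * E" "\<And>x. x \<in> carrier_vec n \<Longrightarrow> 0 \<le> x \<bullet> (Q\<^sup>T * E *\<^sub>v x)"
    "\<And>x. x \<in> carrier_vec n \<Longrightarrow> x \<bullet> (Q\<^sup>T * A *\<^sub>v x) \<le> 0"
proof -
  note p = ph[unfolded pH_representation_def]
  have J: "J \<in> carrier_mat n n" and R: "R \<in> carrier_mat n n" and Q: "Q \<in> carrier_mat n n"
    and G: "G \<in> carrier_mat n m" and P: "P \<in> carrier_mat n m" using p by auto
  obtain Qi where Qi: "Q * Qi = 1\<^sub>m n" "Qi * Q = 1\<^sub>m (dim_row Qi)"
    using inv Q by (auto simp: invertible_mat_def inverts_mat_def)
  \<comment> \<open>Invertibility does not state the size of the inverse; it is read off from the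
    two products.\<close>
  have "dim_col (Q * Qi) = n" "dim_col (Qi * Q) = dim_row Qi" unfolding Qi by simp_all
  hence Qic: "Qi \<in> carrier_mat n n" using Q by auto
  have K: "Qi\<^sup>T * Q\<^sup>T = 1\<^sub>m n"
    using transpose_mult[OF Q Qic] Qi(1) by simp
  have "det Qi\<^sup>T * det Q\<^sup>T = 1"
    using det_mult[of "Qi\<^sup>T" n "Q\<^sup>T"] Q Qic by (simp add: K)
  hence detK: "det Qi\<^sup>T \<noteq> 0" by auto
  have "P = (Qi\<^sup>T * Q\<^sup>T) * P" using P by (simp add: K)
  also have "\<dots> = Qi\<^sup>T * (Q\<^sup>T * P)" using Q Qic P by (intro assoc_mult_mat) auto
  also have "\<dots> = 0\<^sub>m n m" using p Qic by simp
  finally have P0: "P = 0\<^sub>m n m" .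
  have BG: "B = G" using p G by (auto simp: P0 intro!: eq_matI)
  have "C = B\<^sup>T * Q" using p G unfolding BG by (simp add: P0)
  hence CB: "C\<^sup>T = Q\<^sup>T * B" using dims Q by (simp add: transpose_mult[of "B\<^sup>T" m n Q n])
  have psdE: "(Q\<^sup>T * E)\<^sup>T = Q\<^sup>T * E" "\<And>x. x \<in> carrier_vec n \<Longrightarrow> 0 \<le> x \<bullet> (Q\<^sup>T * E *\<^sub>v x)"
  proof -
    have psdE: "psd_mat (Q\<^sup>T * E)" using p by blast
    show "(Q\<^sup>T * E)\<^sup>T = Q\<^sup>T * E" using psdE by (simp only: psd_mat_def)
    show "0 \<le> x \<bullet> (Q\<^sup>T * E *\<^sub>v x)" if "x \<in> carrier_vec n" for x
      using psdE that Q unfolding psd_mat_def by (metis carrier_matD(2) index_mult_mat(2) index_transpose_mat(2))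
  qed
  define F where "F = Q\<^sup>T * J * Q"
  define H where "H = Q\<^sup>T * R * Q"
  have F: "F \<in> carrier_mat n n" and H: "H \<in> carrier_mat n n" using J R Q by (simp_all add: F_def H_def)
  have "Q\<^sup>T * A = Q\<^sup>T * ((J - R) * Q)"
    using p by blast
  also have "\<dots> = Q\<^sup>T * (J - R) * Q"
    using J R Q by (intro assoc_mult_mat[symmetric, of _ n n _ n _ n]) auto
  also have "\<dots> = F - H"
    unfolding F_def H_def using J R Q
    by (simp add: mult_minus_distrib_mat[of _ n n _ n] minus_mult_distrib_mat[of _ n n _ _ n])
  finally have QA: "Q\<^sup>T * A = F - H" .
  have "x \<bullet> (Q\<^sup>T * A *\<^sub>v x) \<le> 0" if x: "x \<in> carrier_vec n" for x
  proof -
    have "F = - F\<^sup>T" using p by (simp add: F_def)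
    hence "x \<bullet> (F *\<^sub>v x) = 0" by (rule skew_quadratic_form_eq_0[OF F _ x])
    moreover have "x \<bullet> (H *\<^sub>v x) \<ge> 0"
      using p x H unfolding psd_mat_def H_def[symmetric] by simp
    moreover have "(F - H) *\<^sub>v x = F *\<^sub>v x - H *\<^sub>v x"
      using F H x by (intro minus_mult_distrib_mat_vec) auto
    ultimately show ?thesis
      using F H x unfolding QA by (simp add: scalar_prod_minus_distrib[of _ n])
  qed
  thus thesis using that[of "Qi\<^sup>T"] Q Qic K detK CB psdE by auto
qed

text \<open>Inserts \<open>K * H = 1\<close> and \<open>V * V\<^sup>T = 1\<close> between
  \<open>U\<close> and \<open>Y\<close>. With \<open>H = Q\<^sup>T\<close> the same left factor
  appears for \<open>E\<close>, \<open>A\<close> and \<open>B\<close>, while the right factor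
  \<open>Z\<close> may differ.\<close>

lemma mult_factor_through_congruence:
  fixes Y :: "real mat"
  assumes V: "orthonormal_mat n V" and U: "U \<in> carrier_mat n n" and K: "K \<in> carrier_mat n n" "K * H = 1\<^sub>m n"
    and H: "H \<in> carrier_mat n n" and Y: "Y \<in> carrier_mat n q" and Z: "Z \<in> carrier_mat q q"
  shows "U * Y * Z = (U * (K * V)) * (V\<^sup>T * (H * Y) * Z)"
proof -
  note v = orthonormal_matD[OF V]
  have "(U * (K * V)) * (V\<^sup>T * (H * Y) * Z) = U * (K * ((V * V\<^sup>T) * (H * (Y * Z))))"
    using v(1) U K(1) H Y Z by (simp add: assoc_mult_mat[of _ n n _ n _ n] assoc_mult_mat[of _ n n _ n _ q]
        assoc_mult_mat[of _ n n _ q _ q])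
  also have "\<dots> = U * ((K * H) * (Y * Z))"
    using v(1) U K(1) H Y Z by (simp add: v(3) assoc_mult_mat[of _ n n _ n _ q])
  also have "\<dots> = U * Y * Z"
    using U Y Z by (simp add: K(2) assoc_mult_mat[of _ n n _ q _ q])
  finally show ?thesis ..
qed

theorem lemma4p1:
  fixes n m :: nat and E A B C :: "real mat"
  assumes "E \<in> carrier_mat n n" and "A \<in> carrier_mat n n"
    and "B \<in> carrier_mat n m" and "C \<in> carrier_mat m n"
    and "\<exists>J R Q G P. pH_representation n m E A B C J R Q G P \<and> invertible_mat Q"
  shows "\<exists>n1 n2 n3 n4 n5 m1 :: nat.
    n1 + n2 + n3 + n4 + n5 = n \<and> n1 + m1 + n3 = m \<and>
    (\<exists>U V W. orthonormal_mat n U \<and> orthonormal_mat n V \<and> orthonormal_mat m W \<and>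
      (\<exists>E11 E12 E21 E22
         B11 B13 B23 B33
         A11 A12 A13 A14 A15 A21 A22 A23 A24 A25 A31
         A32 A33 A34 A35 A41 A42 A43 A44 A51 A52 A53
         C11 C31 C32 C33.
        E11 \<in> carrier_mat n1 n1 \<and> E12 \<in> carrier_mat n1 n2 \<and> E21 \<in> carrier_mat n2 n1 \<and> 
        E22 \<in> carrier_mat n2 n2 \<and>
        B11 \<in> carrier_mat n1 n1 \<and> B13 \<in> carrier_mat n1 n3 \<and> B23 \<in> carrier_mat n2 n3 \<and> 
        B33 \<in> carrier_mat n3 n3 \<and>
        A11 \<in> carrier_mat n1 n1 \<and> A12 \<in> carrier_mat n1 n2 \<and> A13 \<in> carrier_mat n1 n3 \<and> 
        A14 \<in> carrier_mat n1 n4 \<and> A15 \<in> carrier_mat n1 n5 \<and> A21 \<in> carrier_mat n2 n1 \<and> 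
        A22 \<in> carrier_mat n2 n2 \<and> A23 \<in> carrier_mat n2 n3 \<and> A24 \<in> carrier_mat n2 n4 \<and> 
        A25 \<in> carrier_mat n2 n5 \<and> A31 \<in> carrier_mat n3 n1 \<and> A32 \<in> carrier_mat n3 n2 \<and> 
        A33 \<in> carrier_mat n3 n3 \<and> A34 \<in> carrier_mat n3 n4 \<and> A35 \<in> carrier_mat n3 n5 \<and> 
        A41 \<in> carrier_mat n4 n1 \<and> A42 \<in> carrier_mat n4 n2 \<and> A43 \<in> carrier_mat n4 n3 \<and> 
        A44 \<in> carrier_mat n4 n4 \<and> A51 \<in> carrier_mat n5 n1 \<and> A52 \<in> carrier_mat n5 n2 \<and> 
        A53 \<in> carrier_mat n5 n3 \<and>
        C11 \<in> carrier_mat n1 n1 \<and> C31 \<in> carrier_mat n3 n1 \<and> C32 \<in> carrier_mat n3 n2 \<and> 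
        C33 \<in> carrier_mat n3 n3 \<and>
        U * E * V =
          (E11 @\<^sub>c E12 @\<^sub>c 0\<^sub>m n1 n3 @\<^sub>c 0\<^sub>m n1 n4 @\<^sub>c 0\<^sub>m n1 n5) @\<^sub>r
          (E21 @\<^sub>c E22 @\<^sub>c 0\<^sub>m n2 n3 @\<^sub>c 0\<^sub>m n2 n4 @\<^sub>c 0\<^sub>m n2 n5) @\<^sub>r
          (0\<^sub>m n3 n1 @\<^sub>c 0\<^sub>m n3 n2 @\<^sub>c 0\<^sub>m n3 n3 @\<^sub>c 0\<^sub>m n3 n4 @\<^sub>c 0\<^sub>m n3 n5) @\<^sub>r
          (0\<^sub>m n4 n1 @\<^sub>c 0\<^sub>m n4 n2 @\<^sub>c 0\<^sub>m n4 n3 @\<^sub>c 0\<^sub>m n4 n4 @\<^sub>c 0\<^sub>m n4 n5) @\<^sub>r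
          (0\<^sub>m n5 n1 @\<^sub>c 0\<^sub>m n5 n2 @\<^sub>c 0\<^sub>m n5 n3 @\<^sub>c 0\<^sub>m n5 n4 @\<^sub>c 0\<^sub>m n5 n5) \<and>
        U * B * W =
          (B11 @\<^sub>c 0\<^sub>m n1 m1 @\<^sub>c B13) @\<^sub>r
          (0\<^sub>m n2 n1 @\<^sub>c 0\<^sub>m n2 m1 @\<^sub>c B23) @\<^sub>r
          (0\<^sub>m n3 n1 @\<^sub>c 0\<^sub>m n3 m1 @\<^sub>c B33) @\<^sub>r
          (0\<^sub>m n4 n1 @\<^sub>c 0\<^sub>m n4 m1 @\<^sub>c 0\<^sub>m n4 n3) @\<^sub>r
          (0\<^sub>m n5 n1 @\<^sub>c 0\<^sub>m n5 m1 @\<^sub>c 0\<^sub>m n5 n3) \<and>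
        U * A * V =
          (A11 @\<^sub>c A12 @\<^sub>c A13 @\<^sub>c A14 @\<^sub>c A15) @\<^sub>r
          (A21 @\<^sub>c A22 @\<^sub>c A23 @\<^sub>c A24 @\<^sub>c A25) @\<^sub>r
          (A31 @\<^sub>c A32 @\<^sub>c A33 @\<^sub>c A34 @\<^sub>c A35) @\<^sub>r
          (A41 @\<^sub>c A42 @\<^sub>c A43 @\<^sub>c A44 @\<^sub>c 0\<^sub>m n4 n5) @\<^sub>r
          (A51 @\<^sub>c A52 @\<^sub>c A53 @\<^sub>c 0\<^sub>m n5 n4 @\<^sub>c 0\<^sub>m n5 n5) \<and>
        W\<^sup>T * C * V =
          (C11 @\<^sub>c 0\<^sub>m n1 n2 @\<^sub>c 0\<^sub>m n1 n3 @\<^sub>c 0\<^sub>m n1 n4 @\<^sub>c 0\<^sub>m n1 n5) @\<^sub>r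
          (0\<^sub>m m1 n1 @\<^sub>c 0\<^sub>m m1 n2 @\<^sub>c 0\<^sub>m m1 n3 @\<^sub>c 0\<^sub>m m1 n4 @\<^sub>c 0\<^sub>m m1 n5) @\<^sub>r
          (C31 @\<^sub>c C32 @\<^sub>c C33 @\<^sub>c 0\<^sub>m n3 n4 @\<^sub>c 0\<^sub>m n3 n5) \<and>
        mat_rank (four_block_mat E11 E12 E21 E22) = n1 + n2 \<and>
        mat_rank B11 = n1 \<and>
        mat_rank C11 = n1 \<and>
        mat_rank E22 = n2 \<and>
        mat_rank B33 = n3 \<and>
        mat_rank C33 = n3 \<and>
        mat_rank A44 = n4))"
proof -
  obtain J R Q G P where ph: "pH_representation n m E A B C J R Q G P" and inv: "invertible_mat Q"
    using assms(5) by blast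
  note dims = assms(1-4)
  obtain K where Q: "Q \<in> carrier_mat n n" and K: "K \<in> carrier_mat n n" "K * Q\<^sup>T = 1\<^sub>m n" "det K \<noteq> 0"
    and CT: "C\<^sup>T = Q\<^sup>T * B" and sym: "(Q\<^sup>T * E)\<^sup>T = Q\<^sup>T * E"
    and psd: "\<And>x. x \<in> carrier_vec n \<Longrightarrow> 0 \<le> x \<bullet> (Q\<^sup>T * E *\<^sub>v x)"
    and diss: "\<And>x. x \<in> carrier_vec n \<Longrightarrow> x \<bullet> (Q\<^sup>T * A *\<^sub>v x) \<le> 0"
    using pH_representation_nonsingular[OF ph inv dims(1,2,3)] by blast
  have QT: "Q\<^sup>T \<in> carrier_mat n n" using Q by simp
  have QE: "Q\<^sup>T * E \<in> carrier_mat n n" and QA: "Q\<^sup>T * A \<in> carrier_mat n n"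
    using QT dims by simp_all
  obtain n1 n2 n3 n4 n5 m1 V W E0 C11 C1 C33 A44 where
    n: "n1 + n2 + n3 + n4 + n5 = n" and m: "n1 + m1 + n3 = m"
    and V: "orthonormal_mat n V" and W: "orthonormal_mat m W"
    and E0: "E0 \<in> carrier_mat (n1 + n2) (n1 + n2)" "det E0 \<noteq> 0"
    and C11: "C11 \<in> carrier_mat n1 n1" "det C11 \<noteq> 0" and C1: "C1 \<in> carrier_mat n3 (n1 + n2)"
    and C33: "C33 \<in> carrier_mat n3 n3" "det C33 \<noteq> 0"
    and A44: "A44 \<in> carrier_mat n4 n4" "det A44 \<noteq> 0"
    and Sb: "V\<^sup>T * (Q\<^sup>T * E) * V = four_block_mat E0 (0\<^sub>m (n1 + n2) (n3 + n4 + n5)) (0\<^sub>m (n3 + n4 + n5) (n1 + n2))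
      (0\<^sub>m (n3 + n4 + n5) (n3 + n4 + n5))"
    and Db: "W\<^sup>T * C * V = four_block_mat
      (four_block_mat C11 (0\<^sub>m n1 n2) (0\<^sub>m m1 n1) (0\<^sub>m m1 n2)) (0\<^sub>m (n1 + m1) (n3 + n4 + n5))
      C1 (four_block_mat C33 (0\<^sub>m n3 (n4 + n5)) (0\<^sub>m 0 n3) (0\<^sub>m 0 (n4 + n5)))"
    and Ab: "mat_block (V\<^sup>T * (Q\<^sup>T * A) * V) (n1 + n2 + n3) (n1 + n2 + n3) (n4 + n5) (n4 + n5) =
      four_block_mat A44 (0\<^sub>m n4 n5) (0\<^sub>m n5 n4) (0\<^sub>m n5 n5)"
    using congruence_psd_staircase[OF QE QA dims(4) sym psd diss] by metis
  note v = orthonormal_matD(1)[OF V] and w = orthonormal_matD(1)[OF W]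
  obtain U where U: "orthonormal_mat n U" and ut: "upper_triangular (U * (K * V))"
    using ex_orthonormal_mult_upper_triangular[of "K * V" n] K(1) v by auto
  note u = orthonormal_matD(1)[OF U]
  define T where "T = U * (K * V)"
  have T: "T \<in> carrier_mat n n" "upper_triangular T" "det T \<noteq> 0"
    using u K v ut orthonormal_mat_det[OF U] orthonormal_mat_det[OF V]
    by (simp_all add: T_def det_mult[of _ n])
  define S where "S = V\<^sup>T * (Q\<^sup>T * E) * V"
  define F where "F = V\<^sup>T * (Q\<^sup>T * A) * V"
  define D where "D = W\<^sup>T * C * V"
  have S: "S \<in> carrier_mat n n" and F: "F \<in> carrier_mat n n" and D: "D \<in> carrier_mat m n"
    using QE QA dims v w by (simp_all add: S_def F_def D_def)
  define X where "X = U * E * V"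
  define Y where "Y = U * B * W"
  define Z where "Z = U * A * V"
  \<comment> \<open>All three transformed matrices are \<open>T\<close> times a reduced one; for
    \<open>B\<close> this uses \<open>C\<^sup>T = Q\<^sup>T * B\<close>, so the transposed pattern
    of \<open>C\<close> appears.\<close>
  have XT: "X = T * S" and ZT: "Z = T * F" and YT: "Y = T * D\<^sup>T"
  proof -
    note factor = mult_factor_through_congruence[OF V u K(1,2) QT]
    show "X = T * S" unfolding X_def T_def S_def by (rule factor[OF dims(1) v])
    show "Z = T * F" unfolding Z_def T_def F_def by (rule factor[OF dims(2) v])
    have "Y = T * (V\<^sup>T * C\<^sup>T * W)" unfolding Y_def T_def CT by (rule factor[OF dims(3) w])
    also have "V\<^sup>T * C\<^sup>T * W = D\<^sup>T"
      unfolding D_def using dims v w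
      by (simp add: transpose_mult[of _ m n _ n] transpose_mult[of _ m m _ n] assoc_mult_mat[of _ n n _ m _ m])
    finally show "Y = T * D\<^sup>T" .
  qed
  have DT: "D\<^sup>T \<in> carrier_mat n m" using D by simp
  have X: "X \<in> carrier_mat n n" and Y: "Y \<in> carrier_mat n m" and Z: "Z \<in> carrier_mat n n"
    using XT YT ZT T(1) S DT F by simp_all

  have S0: "S $$ (i, j) = 0" if "i < n" "j < n" "n1 + n2 \<le> i \<or> n1 + n2 \<le> j" for i j
    using that E0 n unfolding S_def Sb by auto
  \<comment> \<open>Vanishing columns of \<open>S\<close> stay zero, and its vanishing rows reach
    the bottom, so they stay zero under \<open>T\<close>.\<close>
  have X0: "X $$ (i, j) = 0" if "i < n" "j < n" "n1 + n2 \<le> i \<or> n1 + n2 \<le> j" for i j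
    unfolding XT by (rule upper_triangular_mult_eq_zero[OF T(1,2) S that(1,2)]) (use S0 that in auto)
  have SE0: "mat_block S 0 0 (n1 + n2) (n1 + n2) = E0"
    unfolding S_def Sb by (rule mat_block_four_block(1)) (use E0 in auto)
  have detX: "det (mat_block X 0 0 (n1 + n2) (n1 + n2)) \<noteq> 0"
    unfolding XT by (rule upper_triangular_mult_det_block[OF T S]) (use n S0 SE0 E0 in auto)
  have E0sym: "E0\<^sup>T = E0"
  proof -
    have "S\<^sup>T = S"
      using sym QE v by (simp add: S_def transpose_mult[of _ n n _ n] assoc_mult_mat[of _ n n _ n _ n])
    moreover have "mat_block S\<^sup>T 0 0 (n1 + n2) (n1 + n2) = (mat_block S 0 0 (n1 + n2) (n1 + n2))\<^sup>T"
      by (rule mat_block_transpose[OF S]) (use n in auto)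
    ultimately show ?thesis by (simp add: SE0)
  qed
  have E0psd: "0 \<le> x \<bullet> (E0 *\<^sub>v x)" if x: "x \<in> carrier_vec (n1 + n2)" for x
  proof -
    obtain y where y: "y \<in> carrier_vec n" "y \<bullet> (S *\<^sub>v y) = x \<bullet> (E0 *\<^sub>v x)"
      using mat_block_quadratic_form[OF S _ x, of 0] n by (auto simp: SE0)
    thus ?thesis
      using psd[of "V *\<^sub>v y"] v congruence_quadratic_form[OF QE v y(1)] by (simp add: S_def)
  qed
  \<comment> \<open>\<open>E0\<close> is symmetric, semidefinite and nonsingular, so its second
    diagonal block is nonsingular; multiplication by a diagonal block of \<open>T\<close> turns it
    into \<open>E22\<close>.\<close>
  have "mat_block S n1 n1 n2 n2 = mat_block E0 n1 n1 n2 n2"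
    unfolding SE0[symmetric] by (simp add: mat_block_mat_block)
  hence "det (mat_block S n1 n1 n2 n2) \<noteq> 0"
    using psd_nonsingular_principal_block[OF E0(1) E0sym E0psd E0(2), of n1 n2] by simp
  hence detX22: "det (mat_block X n1 n1 n2 n2) \<noteq> 0"
    unfolding XT by (intro upper_triangular_mult_det_block[OF T S]) (use n S0 in auto)

  have D0: "D $$ (i, j) = 0"
    if "i < m" "j < n" "i < n1 + m1 \<and> n1 \<le> j \<or> n1 \<le> i \<and> i < n1 + m1 \<or> n1 + n2 + n3 \<le> j" for i j
    using that C11 C1 C33 n m unfolding D_def Db by auto
  \<comment> \<open>Transposed, each zero region of \<open>D\<close> consists of column segments
    that reach the last row, as the triangular factor requires.\<close>
  have Y0: "Y $$ (i, j) = 0"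
    if "i < n" "j < m" "j < n1 + m1 \<and> n1 \<le> i \<or> n1 \<le> j \<and> j < n1 + m1 \<or> n1 + n2 + n3 \<le> i" for i j
    unfolding YT by (rule upper_triangular_mult_eq_zero[OF T(1,2) DT that(1,2)]) (use D D0 that in auto)
  have D11: "mat_block D 0 0 n1 n1 = C11" and D33: "mat_block D (n1 + m1) (n1 + n2) n3 n3 = C33"
    unfolding D_def Db by (rule eq_matI, use C11 C1 C33 in auto)+
  \<comment> \<open>\<open>B11\<close> is a diagonal block of \<open>T\<close> times the transpose
    of \<open>C11\<close>; likewise for \<open>B33\<close> and \<open>C33\<close> below.\<close>
  have detY11: "det (mat_block Y 0 0 n1 n1) \<noteq> 0"
    unfolding YT
    by (rule upper_triangular_mult_det_block[OF T DT])
      (use n m D D0 C11 in \<open>auto simp: mat_block_transpose[OF D] D11 det_transpose[OF C11(1)]\<close>)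
  have detY33: "det (mat_block Y (n1 + n2) (n1 + m1) n3 n3) \<noteq> 0"
    unfolding YT
    by (rule upper_triangular_mult_det_block[OF T DT])
      (use n m D D0 C33 in \<open>auto simp: mat_block_transpose[OF D] D33 det_transpose[OF C33(1)]\<close>)

  \<comment> \<open>The staircase reduction describes only the trailing block of size
    \<open>n4 + n5\<close>, so the indices are shifted to its corner.\<close>
  have F0: "F $$ (i, j) = 0"
    if "n1 + n2 + n3 \<le> i" "i < n" "n1 + n2 + n3 \<le> j" "j < n"
      "n1 + n2 + n3 + n4 \<le> i \<or> n1 + n2 + n3 + n4 \<le> j" for i j
  proof -
    define a b where "a = i - (n1 + n2 + n3)" and "b = j - (n1 + n2 + n3)"
    have ab: "i = n1 + n2 + n3 + a" "j = n1 + n2 + n3 + b" using that by (auto simp: a_def b_def)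
    have "F $$ (i, j) = mat_block F (n1 + n2 + n3) (n1 + n2 + n3) (n4 + n5) (n4 + n5) $$ (a, b)"
      using that n ab by simp
    also have "\<dots> = 0" using that n ab A44(1) unfolding F_def Ab by auto
    finally show ?thesis .
  qed
  have Z0: "Z $$ (i, j) = 0"
    if "n1 + n2 + n3 \<le> i" "i < n" "n1 + n2 + n3 \<le> j" "j < n"
      "n1 + n2 + n3 + n4 \<le> i \<or> n1 + n2 + n3 + n4 \<le> j" for i j
    unfolding ZT by (rule upper_triangular_mult_eq_zero[OF T(1,2) F that(2,4)]) (use F0 that in auto)
  have "mat_block F (n1 + n2 + n3) (n1 + n2 + n3) n4 n4 =
      mat_block (mat_block F (n1 + n2 + n3) (n1 + n2 + n3) (n4 + n5) (n4 + n5)) 0 0 n4 n4"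
    by (simp add: mat_block_mat_block)
  also have "\<dots> = A44"
    unfolding F_def Ab by (rule mat_block_four_block(1)) (use A44 in auto)
  finally have detZ: "det (mat_block Z (n1 + n2 + n3) (n1 + n2 + n3) n4 n4) \<noteq> 0"
    unfolding ZT using A44 n F0 by (intro upper_triangular_mult_det_block[OF T F]) auto

  \<comment> \<open>Writing the size as the sum of the five block sizes lets the splitting rules cut
    \<open>M\<close> into blocks.\<close>
  have n_split: "M = mat_block M 0 0 (n1 + n2 + n3 + n4 + n5) (n1 + n2 + n3 + n4 + n5)"
    if "M \<in> carrier_mat n n" for M :: "real mat"
    unfolding n using mat_block_full[OF that] by simp
  \<comment> \<open>The matrix is cut at the partition points and compared block by block; each
    prescribed zero block reduces to \<open>X0\<close> and linear arithmetic on the offsets. The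
    other three patterns are obtained in the same way.\<close>
  have eqE: "U * E * V =
          (mat_block X 0 0 n1 n1 @\<^sub>c mat_block X 0 n1 n1 n2 @\<^sub>c 0\<^sub>m n1 n3 @\<^sub>c 0\<^sub>m n1 n4 @\<^sub>c 0\<^sub>m n1 n5) @\<^sub>r
          (mat_block X n1 0 n2 n1 @\<^sub>c mat_block X n1 n1 n2 n2 @\<^sub>c 0\<^sub>m n2 n3 @\<^sub>c 0\<^sub>m n2 n4 @\<^sub>c 0\<^sub>m n2 n5) @\<^sub>r
          (0\<^sub>m n3 n1 @\<^sub>c 0\<^sub>m n3 n2 @\<^sub>c 0\<^sub>m n3 n3 @\<^sub>c 0\<^sub>m n3 n4 @\<^sub>c 0\<^sub>m n3 n5) @\<^sub>r
          (0\<^sub>m n4 n1 @\<^sub>c 0\<^sub>m n4 n2 @\<^sub>c 0\<^sub>m n4 n3 @\<^sub>c 0\<^sub>m n4 n4 @\<^sub>c 0\<^sub>m n4 n5) @\<^sub>r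
          (0\<^sub>m n5 n1 @\<^sub>c 0\<^sub>m n5 n2 @\<^sub>c 0\<^sub>m n5 n3 @\<^sub>c 0\<^sub>m n5 n4 @\<^sub>c 0\<^sub>m n5 n5)"
    unfolding X_def[symmetric]
    by (subst n_split[OF X], unfold mat_block_append_rows5, unfold mat_block_append_cols5)
      (intro arg_cong2[of _ _ _ _ append_rows] arg_cong2[of _ _ _ _ append_cols] refl mat_block_eq_zero; 
        intro X0; use n in linarith)
  have eqB: "U * B * W =
          (mat_block Y 0 0 n1 n1 @\<^sub>c 0\<^sub>m n1 m1 @\<^sub>c mat_block Y 0 (n1 + m1) n1 n3) @\<^sub>r
          (0\<^sub>m n2 n1 @\<^sub>c 0\<^sub>m n2 m1 @\<^sub>c mat_block Y n1 (n1 + m1) n2 n3) @\<^sub>r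
          (0\<^sub>m n3 n1 @\<^sub>c 0\<^sub>m n3 m1 @\<^sub>c mat_block Y (n1 + n2) (n1 + m1) n3 n3) @\<^sub>r
          (0\<^sub>m n4 n1 @\<^sub>c 0\<^sub>m n4 m1 @\<^sub>c 0\<^sub>m n4 n3) @\<^sub>r
          (0\<^sub>m n5 n1 @\<^sub>c 0\<^sub>m n5 m1 @\<^sub>c 0\<^sub>m n5 n3)"
  proof -
    have "Y = mat_block Y 0 0 (n1 + n2 + n3 + n4 + n5) (n1 + m1 + n3)"
      unfolding n m using mat_block_full[OF Y] by simp
    thus ?thesis
      unfolding Y_def[symmetric]
      by (rule trans, unfold mat_block_append_rows5, unfold mat_block_append_cols3)
        (intro arg_cong2[of _ _ _ _ append_rows] arg_cong2[of _ _ _ _ append_cols] refl mat_block_eq_zero;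
          intro Y0; use n m in linarith)
  qed
  have eqA: "U * A * V =
          (mat_block Z 0 0 n1 n1 @\<^sub>c mat_block Z 0 n1 n1 n2 @\<^sub>c mat_block Z 0 (n1 + n2) n1 n3 @\<^sub>c mat_block Z 0 (n1 + n2 + n3) n1 n4 @\<^sub>c mat_block Z 0 (n1 + n2 + n3 + n4) n1 n5) @\<^sub>r
          (mat_block Z n1 0 n2 n1 @\<^sub>c mat_block Z n1 n1 n2 n2 @\<^sub>c mat_block Z n1 (n1 + n2) n2 n3 @\<^sub>c mat_block Z n1 (n1 + n2 + n3) n2 n4 @\<^sub>c mat_block Z n1 (n1 + n2 + n3 + n4) n2 n5) @\<^sub>r
          (mat_block Z (n1 + n2) 0 n3 n1 @\<^sub>c mat_block Z (n1 + n2) n1 n3 n2 @\<^sub>c mat_block Z (n1 + n2) (n1 + n2) n3 n3 @\<^sub>c mat_block Z (n1 + n2) (n1 + n2 + n3) n3 n4 @\<^sub>c mat_block Z (n1 + n2) (n1 + n2 + n3 + n4) n3 n5) @\<^sub>r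
          (mat_block Z (n1 + n2 + n3) 0 n4 n1 @\<^sub>c mat_block Z (n1 + n2 + n3) n1 n4 n2 @\<^sub>c mat_block Z (n1 + n2 + n3) (n1 + n2) n4 n3 @\<^sub>c mat_block Z (n1 + n2 + n3) (n1 + n2 + n3) n4 n4 @\<^sub>c 0\<^sub>m n4 n5) @\<^sub>r
          (mat_block Z (n1 + n2 + n3 + n4) 0 n5 n1 @\<^sub>c mat_block Z (n1 + n2 + n3 + n4) n1 n5 n2 @\<^sub>c mat_block Z (n1 + n2 + n3 + n4) (n1 + n2) n5 n3 @\<^sub>c 0\<^sub>m n5 n4 @\<^sub>c 0\<^sub>m n5 n5)"
    unfolding Z_def[symmetric]
    by (subst n_split[OF Z], unfold mat_block_append_rows5, unfold mat_block_append_cols5)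
      (intro arg_cong2[of _ _ _ _ append_rows] arg_cong2[of _ _ _ _ append_cols] refl mat_block_eq_zero;
        intro Z0; use n in linarith)
  have eqC: "W\<^sup>T * C * V =
          (mat_block D 0 0 n1 n1 @\<^sub>c 0\<^sub>m n1 n2 @\<^sub>c 0\<^sub>m n1 n3 @\<^sub>c 0\<^sub>m n1 n4 @\<^sub>c 0\<^sub>m n1 n5) @\<^sub>r
          (0\<^sub>m m1 n1 @\<^sub>c 0\<^sub>m m1 n2 @\<^sub>c 0\<^sub>m m1 n3 @\<^sub>c 0\<^sub>m m1 n4 @\<^sub>c 0\<^sub>m m1 n5) @\<^sub>r
          (mat_block D (n1 + m1) 0 n3 n1 @\<^sub>c mat_block D (n1 + m1) n1 n3 n2 @\<^sub>c mat_block D (n1 + m1) (n1 + n2) n3 n3 @\<^sub>c 0\<^sub>m n3 n4 @\<^sub>c 0\<^sub>m n3 n5)"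
  proof -
    have "D = mat_block D 0 0 (n1 + m1 + n3) (n1 + n2 + n3 + n4 + n5)"
      unfolding n m using mat_block_full[OF D] by simp
    thus ?thesis
      unfolding D_def[symmetric]
      by (rule trans, unfold mat_block_append_rows3, unfold mat_block_append_cols5)
        (intro arg_cong2[of _ _ _ _ append_rows] arg_cong2[of _ _ _ _ append_cols] refl mat_block_eq_zero;
          intro D0; use n m in linarith)
  qed
  \<comment> \<open>The four blocks reassemble into the leading block of \<open>X\<close>, whose
    determinant is nonzero by \<open>detX\<close>.\<close>
  have "mat_rank (four_block_mat (mat_block X 0 0 n1 n1) (mat_block X 0 n1 n1 n2)
      (mat_block X n1 0 n2 n1) (mat_block X n1 n1 n2 n2)) = n1 + n2"
    using mat_rank_eq_dim[OF mat_block_carrier detX] four_block_mat_block_consecutive[of X 0 0 n1 n1 n2 n2]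
    by simp
  note ranks = this mat_rank_eq_dim[OF mat_block_carrier detX22] mat_rank_eq_dim[OF mat_block_carrier detY11]
    mat_rank_eq_dim[OF mat_block_carrier detY33] mat_rank_eq_dim[OF mat_block_carrier detZ]
    mat_rank_eq_dim[OF C11, folded D11] mat_rank_eq_dim[OF C33, folded D33]
  show ?thesis
    by (rule exI[of _ "n1"], rule exI[of _ "n2"], rule exI[of _ "n3"], rule exI[of _ "n4"], rule exI[of _ "n5"], rule exI[of _ "m1"],
        intro conjI, rule n, rule m, rule exI[of _ "U"], rule exI[of _ "V"], rule exI[of _ "W"],
        intro conjI, rule U, rule V, rule W,
        rule exI[of _ "mat_block X 0 0 n1 n1"], rule exI[of _ "mat_block X 0 n1 n1 n2"],
        rule exI[of _ "mat_block X n1 0 n2 n1"], rule exI[of _ "mat_block X n1 n1 n2 n2"],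
        rule exI[of _ "mat_block Y 0 0 n1 n1"], rule exI[of _ "mat_block Y 0 (n1 + m1) n1 n3"],
        rule exI[of _ "mat_block Y n1 (n1 + m1) n2 n3"], rule exI[of _ "mat_block Y (n1 + n2) (n1 + m1) n3 n3"],
        rule exI[of _ "mat_block Z 0 0 n1 n1"], rule exI[of _ "mat_block Z 0 n1 n1 n2"],
        rule exI[of _ "mat_block Z 0 (n1 + n2) n1 n3"], rule exI[of _ "mat_block Z 0 (n1 + n2 + n3) n1 n4"],
        rule exI[of _ "mat_block Z 0 (n1 + n2 + n3 + n4) n1 n5"], rule exI[of _ "mat_block Z n1 0 n2 n1"],
        rule exI[of _ "mat_block Z n1 n1 n2 n2"], rule exI[of _ "mat_block Z n1 (n1 + n2) n2 n3"],
        rule exI[of _ "mat_block Z n1 (n1 + n2 + n3) n2 n4"], rule exI[of _ "mat_block Z n1 (n1 + n2 + n3 + n4) n2 n5"],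
        rule exI[of _ "mat_block Z (n1 + n2) 0 n3 n1"], rule exI[of _ "mat_block Z (n1 + n2) n1 n3 n2"],
        rule exI[of _ "mat_block Z (n1 + n2) (n1 + n2) n3 n3"], rule exI[of _ "mat_block Z (n1 + n2) (n1 + n2 + n3) n3 n4"],
        rule exI[of _ "mat_block Z (n1 + n2) (n1 + n2 + n3 + n4) n3 n5"], rule exI[of _ "mat_block Z (n1 + n2 + n3) 0 n4 n1"],
        rule exI[of _ "mat_block Z (n1 + n2 + n3) n1 n4 n2"], rule exI[of _ "mat_block Z (n1 + n2 + n3) (n1 + n2) n4 n3"],
        rule exI[of _ "mat_block Z (n1 + n2 + n3) (n1 + n2 + n3) n4 n4"], rule exI[of _ "mat_block Z (n1 + n2 + n3 + n4) 0 n5 n1"],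
        rule exI[of _ "mat_block Z (n1 + n2 + n3 + n4) n1 n5 n2"], rule exI[of _ "mat_block Z (n1 + n2 + n3 + n4) (n1 + n2) n5 n3"],
        rule exI[of _ "mat_block D 0 0 n1 n1"], rule exI[of _ "mat_block D (n1 + m1) 0 n3 n1"],
        rule exI[of _ "mat_block D (n1 + m1) n1 n3 n2"], rule exI[of _ "mat_block D (n1 + m1) (n1 + n2) n3 n3"],
        intro conjI)
      (fact mat_block_carrier eqE eqB eqA eqC ranks)+
qed

end
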